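(* Let $N$ be an odd prime, $\zeta=e^{2\pi i/N}$, $O=\mathbb{Z}[\zeta]$, and let $\beta\in O$, $\beta\ne0$. Let $S_\beta:R\to Z$ be the signing map defined below, and let $\rho\in R$ be uniformly distributed (in the sense defined below). Then the mean-squared quantization error satisfies $$\Delta_\beta:=\mathrm{E}\left(\|S_\beta(\rho)-\rho\|\right)=N\left(\frac{\Delta_O}{N-1}\,\|\beta\|_\perp+\frac1{12}\right).$$
   Context: $R=\mathbb{R}[x]/\langle x^N-1\rangle$ with coordinates $\alpha=\sum_{i=0}^{N-1}[\alpha]_ix^i$, and $Z\subset R$ the elements with integer coordinates. For $v\in R$, $\|v\|:=\sum_i[v]_i^2$ (the squared Euclidean length). Fourier components: $\sigma_j(v)=\sum_{k=0}^{N-1}[v]_k\zeta^{jk}$, $0\le j\le N-1$. Let $\Phi_N=1+x+\dots+x^{N-1}\in R$, $\pi_0(\rho)=\frac{\sigma_0(\rho)}{N}\Phi_N$, and $R_\perp=\{v\in R:\sigma_0(v)=0\}$. Elements of $O$ are $\gamma=\sum_{k=1}^{N-1}c_k\zeta^k$ ($c_k\in\mathbb{Z}$), with automorphisms $\sigma_j:\zeta\mapsto\zeta^j$; the embedding $\iota:O\to R_\perp$ sends $\gamma$ to the unique $v\in R_\perp$ with $\sigma_j(v)=\sigma_j(\gamma)$ for $1\le j\le N-1$ (i.e. $\iota(\gamma)=\sum c_kx^k-\pi_0(\sum c_kx^k)$), and $\|\gamma\|_\perp:=\|\iota(\gamma)\|=\frac1N\sum_{j=1}^{N-1}|\sigma_j(\gamma)|^2$.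 $Q_O:R_\perp\to O$ is the nearest-point quantizer: $Q_O(u)$ is an element $\gamma\in O$ minimizing $\|u-\iota(\gamma)\|$. $\Delta_O:=\mathrm{E}\|u-\iota(Q_O(u))\|$ with $u$ uniformly distributed on a fundamental domain of the lattice $\iota(O)$ in $R_\perp$. For $\rho\in R$ let $u_\beta(\rho)\in R_\perp$ be the element with $\sigma_j(u_\beta(\rho))=\sigma_j(\rho)/\sigma_j(\beta)$ for $1\le j\le N-1$; set $Q_\beta(\rho)=\beta\,Q_O(u_\beta(\rho))\in\beta O$, and $S_\beta(\rho)=\lceil\iota(Q_\beta(\rho))+\pi_0(\rho)\rfloor\in Z$, where $\lceil\cdot\rfloor$ rounds each coordinate to the nearest integer. "$\rho$ uniformly distributed" means $\rho$ is uniform on a fundamental domain of the lattice $L=\{\lambda\in Z:\ \sum_i[\lambda]_i\zeta^i\in\beta O\}$ (the error $S_\beta(\rho)-\rho$ is $L$-periodic, so this is the large-region average; ties in rounding/nearest points have measure zero). *)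

theory Defs
  imports "HOL-Analysis.Analysis" "Berlekamp_Zassenhaus.Finite_Field"
begin

text \<open>
  The dimension is \<open>N = CARD('p)\<close>.  An element of \<open>R = \<real>[x]/(x^N - 1)\<close> is its coordinate vector
  indexed by \<open>'p mod_ring\<close>, that is by the exponents of \<open>x\<close> modulo \<open>N\<close>; the coordinate
  at \<open>x^k\<close> is \<open>v $ of_nat k\<close>.
\<close>

type_synonym 'p R = "(real, 'p mod_ring) vec"

definition sq_len :: "'p::nontriv R \<Rightarrow> real" where
  "sq_len v = (\<Sum>i\<in>UNIV. (v $ i)\<^sup>2)"

definition Z_lat :: "'p::nontriv R set" where
  "Z_lat = {v. \<forall>i. v $ i \<in> \<int>}"

definition zeta :: "nat \<Rightarrow> complex" where
  "zeta N = cis (2 * pi / real N)"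

definition fourier :: "nat \<Rightarrow> 'p::nontriv R \<Rightarrow> complex" where
  "fourier j v = (\<Sum>k<CARD('p). of_real (v $ of_nat k) * zeta CARD('p) ^ (j * k))"

definition Phi :: "'p::nontriv R" where
  "Phi = (\<chi> i. 1)"

text \<open>The component of index 0 is a real number, so taking its real part loses nothing.\<close>

definition pi0 :: "'p::nontriv R \<Rightarrow> 'p R" where
  "pi0 v = (Re (fourier 0 v) / real CARD('p)) *\<^sub>R Phi"

definition R_perp :: "'p::nontriv R set" where
  "R_perp = {v. fourier 0 v = 0}"

definition cyc_int :: "nat \<Rightarrow> complex set" where
  "cyc_int N = {\<Sum>k=1..<N. of_int (c k) * zeta N ^ k | c :: nat \<Rightarrow> int. True}"

text \<open>
  For prime \<open>N\<close> the numbers \<open>\<zeta>, \<dots>, \<zeta>^(N-1)\<close> are linearly independent over the rationals, so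
  the coefficients are determined by the element of \<open>\<int>[\<zeta>]\<close>.
\<close>

definition cyc_coeff :: "nat \<Rightarrow> complex \<Rightarrow> nat \<Rightarrow> int" where
  "cyc_coeff N \<gamma> = (THE c. (\<forall>k. k \<notin> {1..<N} \<longrightarrow> c k = 0) \<and>
                          \<gamma> = (\<Sum>k=1..<N. of_int (c k) * zeta N ^ k))"

definition galois :: "nat \<Rightarrow> nat \<Rightarrow> complex \<Rightarrow> complex" where
  "galois N j \<gamma> = (\<Sum>k=1..<N. of_int (cyc_coeff N \<gamma> k) * zeta N ^ (j * k))"

definition iota :: "complex \<Rightarrow> 'p::nontriv R" where
  "iota \<gamma> = (THE v. v \<in> R_perp \<and> (\<forall>j\<in>{1..<CARD('p)}. fourier j v = galois CARD('p) j \<gamma>))"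

definition sq_len_perp :: "'p::nontriv itself \<Rightarrow> complex \<Rightarrow> real" where
  "sq_len_perp _ \<gamma> = sq_len (iota \<gamma> :: 'p R)"

text \<open>The choice among several nearest points is left open.\<close>

definition nearest_quantizer :: "('p::nontriv R \<Rightarrow> complex) \<Rightarrow> bool" where
  "nearest_quantizer Q \<longleftrightarrow>
     (\<forall>u\<in>R_perp. Q u \<in> cyc_int CARD('p) \<and>
        (\<forall>\<gamma>\<in>cyc_int CARD('p). sq_len (u - iota (Q u)) \<le> sq_len (u - iota \<gamma>)))"

definition u_div :: "complex \<Rightarrow> 'p::nontriv R \<Rightarrow> 'p R" where
  "u_div \<beta> \<rho> = (THE u. u \<in> R_perp \<and>
     (\<forall>j\<in>{1..<CARD('p)}. fourier j u = fourier j \<rho> / galois CARD('p) j \<beta>))"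

definition Q_scaled :: "('p::nontriv R \<Rightarrow> complex) \<Rightarrow> complex \<Rightarrow> 'p R \<Rightarrow> complex" where
  "Q_scaled Q \<beta> \<rho> = \<beta> * Q (u_div \<beta> \<rho>)"

definition signing :: "('p::nontriv R \<Rightarrow> complex) \<Rightarrow> complex \<Rightarrow> 'p R \<Rightarrow> 'p R" where
  "signing Q \<beta> \<rho> = (\<chi> i. of_int (round ((iota (Q_scaled Q \<beta> \<rho>) + pi0 \<rho>) $ i)))"

definition L_lat :: "complex \<Rightarrow> 'p::nontriv R set" where
  "L_lat \<beta> = {l \<in> Z_lat. (\<Sum>k<CARD('p). of_real (l $ of_nat k) * zeta CARD('p) ^ k)
                          \<in> (\<lambda>\<gamma>. \<beta> * \<gamma>) ` cyc_int CARD('p)}"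

text \<open>
  Lebesgue measure of dimension \<open>N - 1\<close> on the hyperplane \<open>R_perp\<close>: the measure of \<open>A\<close> is the volume
  of the cylinder of height 1 over \<open>A\<close>, in the direction of the unit normal \<open>Phi / sqrt N\<close>.
\<close>

definition lebesgue_perp :: "'p::nontriv R measure" where
  "lebesgue_perp =
     completion (distr (restrict_space lborel {v. inner v Phi / sqrt (real CARD('p)) \<in> {0..1}})
                       (restrict_space borel R_perp) (\<lambda>v. v - pi0 v))"

text \<open>
  Translates of \<open>D\<close> by the lattice tile the space up to null sets; exact systems of
  representatives and closed cells overlapping in their boundaries are both included.
\<close>

definition fundamental_domain :: "'a::ab_group_add measure \<Rightarrow> 'a set \<Rightarrow> 'a set \<Rightarrow> bool" where
  "fundamental_domain M \<Lambda> D \<longleftrightarrow> D \<in> sets M \<and> (AE x in M. \<exists>!l. l \<in> \<Lambda> \<and> x - l \<in> D)"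

definition Delta_O :: "('p::nontriv R \<Rightarrow> complex) \<Rightarrow> 'p R set \<Rightarrow> real" where
  "Delta_O Q F = (\<integral>u. sq_len (u - iota (Q u)) \<partial>uniform_measure lebesgue_perp F)"

definition Delta_signing :: "('p::nontriv R \<Rightarrow> complex) \<Rightarrow> complex \<Rightarrow> 'p R set \<Rightarrow> real" where
  "Delta_signing Q \<beta> D = (\<integral>\<rho>. sq_len (signing Q \<beta> \<rho> - \<rho>) \<partial>uniform_measure lebesgue D)"

end

theory Submission
  imports Defs
begin

text \<open>
  On the strict Voronoi cell of the lattice \<open>iota ` O\<close> the quantizer is zero, so after translating \<open>\<rho>\<close>
  by a vector of \<open>L_lat \<beta>\<close> the signing error is the sum of two orthogonal parts: the component of
  \<open>\<rho>\<close> in \<open>R_perp\<close>, which is \<open>\<beta>\<close> times a point \<open>u\<close> of the Voronoi cell, and the rounding error of the mean of \<open>\<rho>\<close>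
  in the direction \<open>Phi\<close>.  All coordinates are rounded by the same amount, uniform on an interval of
  length 1, which gives \<open>N / 12\<close>.  For the first part, the Galois group acts on \<open>R\<close> by permutations of the
  coordinates that preserve the Voronoi cell and permute the Fourier components, so the mean of
  \<open>|\<sigma>_j(u)|^2\<close> is the same for all \<open>j \<noteq> 0\<close>; by Parseval it equals \<open>N \<Delta>_O / (N - 1)\<close>, and multiplication
  by \<open>\<beta>\<close> scales it by \<open>|\<sigma>_j(\<beta>)|^2\<close>.
\<close>

section \<open>Fourier analysis on the cyclic group\<close>

text \<open>Two freedoms in the statement shape the proof: the quantizer may choose arbitrarily on
  ties, so the errors need not be Borel, and the fundamental domains are arbitrary. Both are
  absorbed by one unfolding argument: a function that on almost every point is a lattice translate
  of a Borel function \<open>h\<close> on one Borel domain \<open>W\<close> has, over every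
  fundamental domain, the integral of \<open>h\<close> over \<open>W\<close>. The lattice
  \<open>L_lat \<beta>\<close> is not the orthogonal sum of its projections: over a point of
  \<beta>O lies a coset of the integer multiples of \<open>Phi\<close>, whose means are shifted by a
  multiple of 1/N. A cylinder of height 1 over \<beta> times the Voronoi cell still meets each fibre
  exactly once. No covolume or determinant is computed. Each expectation is a quotient of two
  integrals, in which the normalisation of the measure on \<open>R_perp\<close> and the Jacobian of
  multiplication by \<beta> cancel. The arithmetic input is that an integer relation between the
  powers of \<zeta> has equal coefficients. It gives a meaning to \<open>cyc_coeff\<close>, hence to
  \<open>galois\<close> and \<open>iota\<close>, and it gives that no conjugate of \<beta> vanishes,
  so that division by \<beta> makes sense.\<close>

definition chr :: "nat \<Rightarrow> 'p::nontriv mod_ring \<Rightarrow> complex" where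
  "chr j i = zeta CARD('p) ^ (j * nat (to_int_mod_ring i))"

lemma card_nontriv_pos: "0 < CARD('p::nontriv)"
  by simp

lemma zeta_power_card [simp]: "0 < N \<Longrightarrow> zeta N ^ N = 1"
  unfolding zeta_def by (simp add: Complex.DeMoivre)

lemma zeta_power_mod: "0 < N \<Longrightarrow> zeta N ^ (k mod N) = zeta N ^ k"
  by (metis (no_types, lifting) mult_div_mod_eq mult.left_neutral power_add power_mult power_one zeta_power_card)

lemma zeta_power_mult_mod: "0 < N \<Longrightarrow> zeta N ^ (j * (k mod N)) = zeta N ^ (j * k)"
  by (metis mod_mult_right_eq zeta_power_mod)

lemma norm_zeta [simp]: "norm (zeta N) = 1"
  by (simp add: zeta_def)

lemma zeta_power_neq_1:
  assumes "0 < k" "k < N"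
  shows "zeta N ^ k \<noteq> 1"
proof
  assume "zeta N ^ k = 1"
  then have "cis (real k * (2 * pi / real N)) = 1"
    unfolding zeta_def Complex.DeMoivre .
  then have "cos (2 * pi * (k / N)) = 1"
    by (metis cis.simps(1) one_complex.simps(1) mult.commute times_divide_eq_left times_divide_eq_right)
  then obtain m :: int where "2 * pi * (k / N) = of_int m * 2 * pi"
    using cos_one_2pi_int by auto
  then have "2 * pi * (real k / real N) = 2 * pi * of_int m" by (simp only: mult_ac)
  then have "real k / real N = of_int m" by (subst (asm) mult_left_cancel) simp_all
  then have "0 < real_of_int m" "real_of_int m < 1"
    using assms by (auto simp flip: \<open>_ = of_int m\<close>)
  then have "0 < m" "m < 1" by simp_all
  then show False by linarith
qed

lemma to_int_mod_ring_of_nat: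
  "nat (to_int_mod_ring (of_nat k :: 'p::nontriv mod_ring)) = k mod CARD('p)"
proof -
  have "to_int_mod_ring (of_nat k :: 'p mod_ring) = int k mod int CARD('p)"
    by transfer simp
  then show ?thesis by (simp add: nat_mod_distrib)
qed

lemma mod_ring_eq_of_nat:
  fixes i :: "'p::nontriv mod_ring"
  obtains k where "k < CARD('p)" "i = of_nat k"
proof
  have r: "0 \<le> to_int_mod_ring i" "to_int_mod_ring i < int CARD('p)"
    using range_to_int_mod_ring[where 'a = 'p] by auto
  then show "nat (to_int_mod_ring i) < CARD('p)" by linarith
  show "i = of_nat (nat (to_int_mod_ring i))"
    using r by (simp add: of_nat_of_int_mod_ring)
qed

lemma of_nat_mod_ring_eq_iff:
  "(of_nat a :: 'p::nontriv mod_ring) = of_nat b \<longleftrightarrow> a mod CARD('p) = b mod CARD('p)"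
proof -
  have "int a mod int CARD('p) = int b mod int CARD('p) \<longleftrightarrow> a mod CARD('p) = b mod CARD('p)"
    by (metis of_nat_eq_iff of_nat_mod)
  moreover have "(of_nat a :: 'p::nontriv mod_ring) = of_nat b \<longleftrightarrow>
      int a mod int CARD('p) = int b mod int CARD('p)"
    by transfer simp
  ultimately show ?thesis by simp
qed

lemma bij_betw_of_nat_mod_ring:
  "bij_betw (of_nat :: nat \<Rightarrow> 'p::nontriv mod_ring) {..<CARD('p)} UNIV"
proof (rule bij_betw_imageI)
  show "inj_on (of_nat :: nat \<Rightarrow> 'p mod_ring) {..<CARD('p)}"
    by (auto simp: inj_on_def of_nat_mod_ring_eq_iff)
  show "(of_nat :: nat \<Rightarrow> 'p mod_ring) ` {..<CARD('p)} = UNIV"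
  proof (intro equalityI subsetI UNIV_I)
    fix i :: "'p mod_ring"
    show "i \<in> of_nat ` {..<CARD('p)}" by (rule mod_ring_eq_of_nat[of i]) auto
  qed
qed

lemma sum_mod_ring:
  "(\<Sum>i\<in>UNIV. f (i :: 'p::nontriv mod_ring)) = (\<Sum>k<CARD('p). f (of_nat k))"
  using sum.reindex_bij_betw[OF bij_betw_of_nat_mod_ring, of f] by simp

lemma chr_of_nat: "chr j (of_nat k :: 'p::nontriv mod_ring) = zeta CARD('p) ^ (j * k)"
  unfolding chr_def to_int_mod_ring_of_nat by (rule zeta_power_mult_mod) simp

lemma chr_add: "chr j (a + b) = chr j a * chr j b"
proof -
  obtain k l where "a = of_nat k" "b = of_nat l" by (metis mod_ring_eq_of_nat)
  then have "chr j (a + b) = chr j (of_nat (k + l) :: 'a mod_ring)" by simp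
  with \<open>a = _\<close> \<open>b = _\<close> show ?thesis
    by (simp only: chr_of_nat power_add distrib_left)
qed

lemma chr_split: "chr j i = chr j k * chr j (i - k)"
  using chr_add[of j k "i - k"] by simp

lemma chr_0 [simp]: "chr j 0 = 1" "chr 0 i = 1"
  by (simp_all add: chr_def)

lemma norm_chr [simp]: "norm (chr j i) = 1"
  by (simp add: chr_def norm_power)

lemma chr_minus: "chr j (- a) = cnj (chr j a)"
proof -
  have "chr j a * chr j (-a) = 1" using chr_add[of j a "-a"] by simp
  moreover have "chr j a * cnj (chr j a) = 1"
    using complex_norm_square[of "chr j a"] by simp
  moreover have "chr j a \<noteq> 0" by (metis norm_chr norm_zero zero_neq_one)
  ultimately show ?thesis by (metis mult_left_cancel)
qed

lemma chr_mult_of_nat: "chr j (of_nat a * i) = chr (j * a) i"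
proof -
  obtain k where "i = of_nat k" by (metis mod_ring_eq_of_nat)
  then show ?thesis
    using chr_of_nat[of j "a * k", where 'p = 'a] by (simp add: chr_of_nat mult.assoc)
qed

lemma chr_cong:
  "j mod CARD('p) = l mod CARD('p) \<Longrightarrow> chr j (i :: 'p::nontriv mod_ring) = chr l i"
  unfolding chr_def
  by (metis card_nontriv_pos mult.commute zeta_power_mult_mod)

lemma sum_chr:
  "(\<Sum>j<CARD('p). chr j (i :: 'p::nontriv mod_ring)) = (if i = 0 then of_nat CARD('p) else 0)"
proof (cases "i = 0")
  case False
  obtain k where k: "k < CARD('p)" "i = of_nat k" by (metis mod_ring_eq_of_nat)
  with False have "0 < k" by (cases k) auto
  then have 1: "zeta CARD('p) ^ k \<noteq> 1" using k zeta_power_neq_1 by blast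
  have "(\<Sum>j<CARD('p). chr j i) = (\<Sum>j<CARD('p). (zeta CARD('p) ^ k) ^ j)"
    by (simp add: k(2) chr_of_nat mult.commute flip: power_mult)
  also have "\<dots> = 0"
    by (subst geometric_sum[OF 1]) (simp add: mult.commute[of k] power_mult flip: power_mult[of _ k])
  finally show ?thesis using False by simp
qed simp

text \<open>Summing over the group instead of over representatives allows reindexing by translations
  and by multiplication with units, which convolution and the Galois action require.\<close>

lemma fourier_eq_sum: "fourier j v = (\<Sum>i\<in>UNIV. of_real (v $ i) * chr j i)"
  by (simp add: fourier_def sum_mod_ring chr_of_nat)

lemma fourier_0: "fourier 0 v = of_real (\<Sum>i\<in>UNIV. v $ i)"
  by (simp add: fourier_eq_sum)

lemma fourier_add: "fourier j (u + v) = fourier j u + fourier j v"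
  by (simp add: fourier_eq_sum sum.distrib distrib_right)

lemma fourier_scaleR: "fourier j (c *\<^sub>R v) = of_real c * fourier j v"
  by (simp add: fourier_eq_sum sum_distrib_left mult.assoc)

lemma fourier_diff: "fourier j (u - v) = fourier j u - fourier j v"
  by (simp add: fourier_eq_sum sum_subtractf left_diff_distrib)

lemma fourier_zero [simp]: "fourier j 0 = 0"
  by (simp add: fourier_eq_sum)

lemma fourier_cong:
  "j mod CARD('p) = l mod CARD('p) \<Longrightarrow> fourier j (v :: 'p::nontriv R) = fourier l v"
  unfolding fourier_eq_sum by (simp add: chr_cong[of j l])

text \<open>Expanding the squares and summing over \<open>j\<close> first leaves only the diagonal,
  by orthogonality of the characters.\<close>

lemma parseval:
  "(\<Sum>j<CARD('p). (norm (fourier j v))\<^sup>2) = real CARD('p) * sq_len (v :: 'p::nontriv R)"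
proof -
  have "complex_of_real (\<Sum>j<CARD('p). (norm (fourier j v))\<^sup>2)
      = (\<Sum>j<CARD('p). \<Sum>i\<in>UNIV. \<Sum>l\<in>UNIV. of_real (v $ i * v $ l) * chr j (i - l))"
    unfolding of_real_sum complex_norm_square fourier_eq_sum cnj_sum sum_product
    by (intro sum.cong refl) (simp add: chr_add chr_minus flip: add_uminus_conv_diff)
  also have "\<dots> = (\<Sum>i\<in>UNIV. \<Sum>l\<in>UNIV. of_real (v $ i * v $ l) * (\<Sum>j<CARD('p). chr j (i - l)))"
    unfolding sum_distrib_left
    by (subst sum.swap, rule sum.cong, rule refl, rule sum.swap)
  also have "\<dots> = (\<Sum>i\<in>UNIV. of_real (v $ i * v $ i) * of_nat CARD('p))"
    unfolding sum_chr by (intro sum.cong refl) (simp add: if_distrib cong: if_cong)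
  also have "\<dots> = of_real (real CARD('p) * sq_len v)"
    by (simp add: sq_len_def sum_distrib_left power2_eq_square mult.commute)
  finally show ?thesis by (simp only: of_real_eq_iff)
qed

lemma sq_len_eq_0_iff: "sq_len v = 0 \<longleftrightarrow> v = 0"
  by (auto simp: sq_len_def sum_nonneg_eq_0_iff vec_eq_iff)

lemma fourier_inject:
  assumes "\<And>j. j < CARD('p) \<Longrightarrow> fourier j u = fourier j (v :: 'p::nontriv R)"
  shows "u = v"
proof -
  have "real CARD('p) * sq_len (u - v) = 0"
    unfolding parseval[symmetric] by (simp add: fourier_diff assms)
  then show ?thesis by (simp add: sq_len_eq_0_iff)
qed

section \<open>Multiplication of the ring and the Galois action in coordinates\<close>

definition conv :: "'p::nontriv R \<Rightarrow> 'p R \<Rightarrow> 'p R" where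
  "conv a v = (\<chi> i. \<Sum>k\<in>UNIV. a $ k * v $ (i - k))"

lemma sum_mod_ring_shift: "(\<Sum>i\<in>UNIV. f (i - k)) = (\<Sum>i\<in>UNIV. f (i :: 'p::nontriv mod_ring))"
  by (rule sum.reindex_bij_witness[of _ "\<lambda>i. i + k" "\<lambda>i. i - k"]) auto

lemma fourier_conv: "fourier j (conv a v) = fourier j a * fourier j v"
proof -
  have "fourier j (conv a v) = (\<Sum>i\<in>UNIV. \<Sum>k\<in>UNIV. (a $ k * chr j k) * (v $ (i - k) * chr j (i - k)))"
    unfolding fourier_eq_sum conv_def
  proof (simp add: sum_distrib_right, intro sum.cong refl)
    fix i k :: "'a mod_ring"
    show "of_real (a $ k) * of_real (v $ (i - k)) * chr j i
        = of_real (a $ k) * chr j k * (of_real (v $ (i - k)) * chr j (i - k))"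
      unfolding chr_split[of j i k] by (simp only: mult_ac)
  qed
  also have "\<dots> = (\<Sum>k\<in>UNIV. \<Sum>i\<in>UNIV. (a $ k * chr j k) * (v $ (i - k) * chr j (i - k)))"
    by (rule sum.swap)
  also have "\<dots> = (\<Sum>k\<in>UNIV. (a $ k * chr j k) * fourier j v)"
    unfolding fourier_eq_sum[of j v] sum_distrib_left[symmetric]
      sum_mod_ring_shift[of "\<lambda>i. of_real (v $ i) * chr j i"] ..
  finally show ?thesis by (simp add: fourier_eq_sum sum_distrib_right)
qed

text \<open>For \<open>a\<close> invertible modulo N with inverse \<open>b\<close> this is the ring
  automorphism sending x to \<open>x^b\<close>: a permutation of coordinates, hence an isometry,
  that lifts the Galois automorphism \<sigma>_b.\<close>

definition dilate :: "nat \<Rightarrow> 'p::nontriv R \<Rightarrow> 'p R" where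
  "dilate a v = (\<chi> i. v $ (of_nat a * i))"

lemma dilate_dilate:
  "(a * b) mod CARD('p) = 1 \<Longrightarrow> dilate a (dilate b v) = (v :: 'p::nontriv R)"
proof -
  assume "(a * b) mod CARD('p) = 1"
  then have "(of_nat (b * a) :: 'p mod_ring) = of_nat 1"
    unfolding of_nat_mod_ring_eq_iff one_mod_card by (simp add: mult.commute)
  then show ?thesis
    by (simp add: dilate_def vec_eq_iff flip: mult.assoc)
qed

lemma fourier_dilate:
  assumes "(a * b) mod CARD('p) = 1"
  shows "fourier j (dilate a v) = fourier (j * b) (v :: 'p::nontriv R)"
proof -
  have "(of_nat (b * a) :: 'p mod_ring) = of_nat 1"
    unfolding of_nat_mod_ring_eq_iff one_mod_card using assms by (simp add: mult.commute)
  then have ba: "of_nat b * (of_nat a * i) = i" "of_nat a * (of_nat b * i) = i" for i :: "'p mod_ring"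
    by (metis mult.assoc mult.commute mult.left_neutral of_nat_1 of_nat_mult)+
  show ?thesis
    unfolding fourier_eq_sum
    by (rule sum.reindex_bij_witness[of _ "\<lambda>i. of_nat b * i" "\<lambda>i. of_nat a * i"])
       (simp_all add: ba dilate_def flip: chr_mult_of_nat)
qed

section \<open>Splitting a vector into its mean and its component orthogonal to
  \<open>Phi\<close>\<close>

definition mean :: "'p::nontriv R \<Rightarrow> real" where
  "mean v = (\<Sum>i\<in>UNIV. v $ i) / real CARD('p)"

definition perp :: "'p::nontriv R \<Rightarrow> 'p R" where
  "perp v = v - mean v *\<^sub>R Phi"

lemma pi0_eq: "pi0 v = mean v *\<^sub>R Phi"
  by (simp add: pi0_def mean_def fourier_0)

lemma perp_eq: "perp v = v - pi0 v"
  by (simp add: perp_def pi0_eq)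

lemma perp_nth [simp]: "perp v $ i = v $ i - mean v"
  by (simp add: perp_def Phi_def)

lemma linear_mean: "linear mean"
  by (rule linearI) (simp_all add: mean_def sum.distrib add_divide_distrib sum_distrib_left)

lemma linear_perp: "linear perp"
  by (rule linearI) (simp_all add: vec_eq_iff linear_add[OF linear_mean] linear_scale[OF linear_mean] algebra_simps)

lemma mean_Phi [simp]: "mean Phi = 1"
  by (simp add: mean_def Phi_def)

lemma mean_perp [simp]: "mean (perp v) = 0"
  unfolding perp_def by (simp add: linear_diff[OF linear_mean] linear_scale[OF linear_mean])

lemma perp_Phi [simp]: "perp Phi = 0"
  by (simp add: perp_def)

lemma R_perp_iff: "v \<in> R_perp \<longleftrightarrow> mean v = 0"
  unfolding R_perp_def mem_Collect_eq fourier_0 of_real_eq_0_iff mean_def by simp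

lemma fourier_0_mean: "fourier 0 v = of_real (real CARD('p) * mean (v :: 'p::nontriv R))"
  by (simp add: fourier_0 mean_def)

lemma perp_in_R_perp [simp]: "perp v \<in> R_perp"
  by (simp add: R_perp_iff)

lemma perp_ident: "v \<in> R_perp \<Longrightarrow> perp v = v"
  by (simp add: R_perp_iff perp_def)

lemma fourier_Phi:
  assumes "0 < j" "j < CARD('p)"
  shows "fourier j (Phi :: 'p::nontriv R) = 0"
proof -
  have 1: "zeta CARD('p) ^ j \<noteq> 1" using assms zeta_power_neq_1 by blast
  have "fourier j (Phi :: 'p R) = (\<Sum>k<CARD('p). (zeta CARD('p) ^ j) ^ k)"
    by (simp add: fourier_def Phi_def flip: power_mult)
  also have "\<dots> = 0"
    by (subst geometric_sum[OF 1]) (simp add: mult.commute[of j] power_mult flip: power_mult[of _ j])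
  finally show ?thesis .
qed

lemma fourier_perp:
  "0 < j \<Longrightarrow> j < CARD('p) \<Longrightarrow> fourier j (perp v) = fourier j (v :: 'p::nontriv R)"
  by (simp add: perp_def fourier_diff fourier_scaleR fourier_Phi)

lemma perp_inject:
  assumes "\<And>j. 0 < j \<Longrightarrow> j < CARD('p) \<Longrightarrow> fourier j u = fourier j (v :: 'p::nontriv R)"
  shows "perp u = perp v"
proof (rule fourier_inject)
  fix j assume "j < CARD('p)"
  then show "fourier j (perp u) = fourier j (perp v)"
    by (cases "j = 0") (simp_all add: fourier_0_mean fourier_perp assms)
qed

lemma Z_lat_diff: "u \<in> Z_lat \<Longrightarrow> v \<in> Z_lat \<Longrightarrow> u - v \<in> Z_lat"
  by (simp add: Z_lat_def)

lemma Z_lat_add: "u \<in> Z_lat \<Longrightarrow> v \<in> Z_lat \<Longrightarrow> u + v \<in> Z_lat"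
  by (simp add: Z_lat_def)

lemma Z_lat_int_Phi: "c \<in> \<int> \<Longrightarrow> c *\<^sub>R Phi \<in> Z_lat"
  by (simp add: Z_lat_def Phi_def)

lemma Z_lat_conv: "u \<in> Z_lat \<Longrightarrow> v \<in> Z_lat \<Longrightarrow> conv u v \<in> Z_lat"
  by (auto simp: Z_lat_def conv_def)

lemma Z_lat_dilate: "v \<in> Z_lat \<Longrightarrow> dilate a v \<in> Z_lat"
  by (auto simp: Z_lat_def dilate_def)

section \<open>Linear independence of the powers of a root of unity\<close>

lemma ex_inverse_mod:
  assumes "prime (N :: nat)" "0 < a" "a < N"
  obtains b where "(a * b) mod N = 1" "0 < b mod N"
proof -
  have "coprime a N"
    using assms by (metis coprime_commute prime_imp_coprime nat_dvd_not_less)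
  then obtain b where "[a * b = 1] (mod N)"
    using cong_solve_coprime_nat by auto
  then have ab: "(a * b) mod N = 1"
    using prime_gt_1_nat[OF assms(1)] by (simp add: cong_def)
  moreover have "b mod N \<noteq> 0"
  proof
    assume "b mod N = 0"
    then have "(a * b) mod N = 0" by auto
    with ab show False by simp
  qed
  ultimately show ?thesis using that by blast
qed

text \<open>
  The cyclic convolution \<open>h\<close> of all Galois conjugates of \<open>g\<close> is the norm of \<open>g\<close>: its nontrivial
  Fourier components vanish, so it is an integer multiple of \<open>Phi\<close>.
\<close>

lemma mean_in_Ints_if_fourier_eq_0:
  fixes g :: "'p::nontriv R"
  assumes "prime CARD('p)" "g \<in> Z_lat" "fourier 1 g = 0"
  shows "mean g \<in> \<int>"
proof -
  have "\<exists>h\<in>Z_lat :: 'p R set. \<forall>j. fourier j h = (\<Prod>a\<in>A. fourier j (dilate a g))" if "finite A" for A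
    using that
  proof induction
    case empty
    have "axis 0 1 \<in> (Z_lat :: 'p R set)" by (auto simp: Z_lat_def axis_def)
    moreover have "fourier j (axis 0 1 :: 'p R) = 1" for j
      by (simp add: fourier_eq_sum axis_def if_distrib if_distribR cong: if_cong)
    ultimately show ?case by (intro bexI[of _ "axis 0 1"]) simp_all
  next
    case (insert a A)
    then obtain h :: "'p R" where "h \<in> Z_lat" "\<And>j. fourier j h = (\<Prod>a\<in>A. fourier j (dilate a g))" by auto
    with insert.hyps assms show ?case
      by (intro bexI[of _ "conv (dilate a g) h"]) (auto simp: fourier_conv Z_lat_conv Z_lat_dilate)
  qed
  from this[of "{1..<CARD('p)}"] obtain h :: "'p R" where h: "h \<in> Z_lat"
    and fh: "\<And>j. fourier j h = (\<Prod>a=1..<CARD('p). fourier j (dilate a g))" by auto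
  have "fourier j h = 0" if j: "0 < j" "j < CARD('p)" for j
  proof -
    obtain b where b: "(j * b) mod CARD('p) = 1" using ex_inverse_mod assms(1) j by blast
    \<comment> \<open>The factor \<open>a = j\<close> of the product is the conjugate of
      \<open>g\<close> that brings the vanishing component 1 to index \<open>j\<close>.\<close>
    have "fourier j (dilate j g) = fourier 1 g"
      unfolding fourier_dilate[OF b] by (rule fourier_cong) (simp only: b one_mod_card)
    with j assms(3) show ?thesis unfolding fh by (intro prod_zero) auto
  qed
  then have "perp h = perp 0" by (intro perp_inject) simp
  \<comment> \<open>All coordinates of \<open>h\<close> agree with its mean, so the mean is an
    integer because the coordinates are.\<close>
  then have "h $ 0 = mean h" by (metis linear_0 linear_perp perp_nth eq_iff_diff_eq_0 zero_index)
  with h obtain c :: int where c: "mean h = of_int c" by (metis (mono_tags) Ints_cases Z_lat_def mem_Collect_eq)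
  have "(\<Sum>i\<in>UNIV. g $ i) \<in> \<int>" using assms(2) by (auto simp: Z_lat_def)
  then obtain s :: int where s: "(\<Sum>i\<in>UNIV. g $ i) = of_int s" by (metis Ints_cases)
  have "fourier 0 (dilate a g) = of_int s" if a: "a \<in> {1..<CARD('p)}" for a
  proof -
    obtain b where b: "(a * b) mod CARD('p) = 1" using ex_inverse_mod[of "CARD('p)" a] assms(1) a by auto
    show ?thesis unfolding fourier_dilate[OF b] using s by (simp add: fourier_0)
  qed
  \<comment> \<open>Every conjugate has the coordinate sum \<open>s\<close>, so N times the integer
    \<open>c\<close> is the power of \<open>s\<close>, and the prime N divides \<open>s\<close>
    itself.\<close>
  then have "fourier 0 h = of_int (s ^ (CARD('p) - 1))" unfolding fh by simp
  then have "of_int (int CARD('p) * c) = (of_int (s ^ (CARD('p) - 1)) :: complex)"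
    unfolding fourier_0_mean c by simp
  then have "int CARD('p) dvd s ^ (CARD('p) - 1)" unfolding of_int_eq_iff by (metis dvd_triv_left)
  moreover have "prime (int CARD('p))" using assms(1) by simp
  ultimately have "int CARD('p) dvd s" using prime_dvd_power by blast
  then show ?thesis unfolding mean_def s by (auto simp: dvd_def)
qed

text \<open>Multiplication by x - 1, since x shifts the coordinates by one.\<close>

definition diffop :: "'p::nontriv R \<Rightarrow> 'p R" where
  "diffop g = (\<chi> i. g $ (i - 1) - g $ i)"

lemma fourier_diffop: "fourier j (diffop (g :: 'p::nontriv R)) = (zeta CARD('p) ^ j - 1) * fourier j g"
proof -
  have "chr j i = chr j (1 :: 'p mod_ring) * chr j (i - 1)" for i :: "'p mod_ring" by (rule chr_split)
  then have "(\<Sum>i\<in>UNIV. of_real (g $ (i - 1)) * chr j i)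
      = (\<Sum>i\<in>UNIV. chr j (1 :: 'p mod_ring) * (of_real (g $ (i - 1)) * chr j (i - 1)))"
    by (intro sum.cong refl) (metis mult.left_commute)
  also have "\<dots> = chr j (1 :: 'p mod_ring) * fourier j g"
    unfolding fourier_eq_sum sum_distrib_left[symmetric]
    using sum_mod_ring_shift[of "\<lambda>i. of_real (g $ i) * chr j i" 1] by simp
  finally show ?thesis
    using chr_of_nat[of j 1, where 'p = 'p]
    by (simp add: fourier_eq_sum diffop_def left_diff_distrib sum_subtractf)
qed

lemma diffop_diff: "diffop (u - v) = diffop u - diffop v"
  by (simp add: diffop_def vec_eq_iff)

lemma diffop_Phi [simp]: "diffop (c *\<^sub>R Phi) = 0"
  by (simp add: diffop_def vec_eq_iff Phi_def)

text \<open>Vanishing at 1 means divisibility by x - 1. The quotient consists of the negated partial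
  sums of the coordinates; the total being 0 is what closes the recursion around the cycle.\<close>

lemma mean_eq_0_imp_diffop:
  fixes g :: "'p::nontriv R"
  assumes "g \<in> Z_lat" "mean g = 0"
  obtains h where "h \<in> Z_lat" "g = diffop h"
proof
  define h :: "'p R" where "h = (\<chi> i. - (\<Sum>k\<le>nat (to_int_mod_ring i). g $ of_nat k))"
  show "h \<in> Z_lat" using assms(1) by (auto simp: h_def Z_lat_def)
  have hn: "h $ of_nat k = - (\<Sum>k\<le>k. g $ of_nat k)" if "k < CARD('p)" for k
    using that by (simp add: h_def to_int_mod_ring_of_nat)
  have "g $ i = h $ (i - 1) - h $ i" for i
  proof -
    obtain k where k: "k < CARD('p)" "i = of_nat k" by (metis mod_ring_eq_of_nat)
    show ?thesis
    proof (cases k)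
      case 0
      \<comment> \<open>At index 0 the predecessor wraps around to N - 1, where the partial sum is
        the full sum and vanishes.\<close>
      have "(of_nat (CARD('p) - 1) :: 'p mod_ring) = of_nat CARD('p) - 1"
        by (metis card_nontriv_pos One_nat_def Suc_leI of_nat_1 of_nat_diff)
      then have "i - 1 = of_nat (CARD('p) - 1)" using 0 k by simp
      moreover have "h $ of_nat (CARD('p) - 1) = - (\<Sum>k<CARD('p). g $ of_nat k)"
        by (subst hn) (simp_all add: lessThan_Suc_atMost[symmetric])
      moreover have "\<dots> = 0" using assms(2) by (simp add: mean_def sum_mod_ring)
      ultimately show ?thesis using hn[of 0] 0 k by simp
    next
      case (Suc l)
      then have "i - 1 = of_nat l" using k by simp
      with Suc k hn[of l] hn[of k] show ?thesis by simp
    qed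
  qed
  then show "g = diffop h" by (simp add: diffop_def vec_eq_iff)
qed

text \<open>
  An element of the kernel of evaluation at \<open>zeta\<close> with coordinate sum 0 is divisible by \<open>x - 1\<close> inside this
  kernel, hence by \<open>(x - 1)^N\<close>, which is 0 modulo \<open>N\<close>; so it is divisible by every power of \<open>N\<close>.
\<close>

definition kernel_lat :: "'p::nontriv R set" where
  "kernel_lat = {g \<in> Z_lat. mean g = 0 \<and> fourier 1 g = 0}"

text \<open>The quotient by x - 1 still vanishes at \<zeta>, as \<zeta> is not 1, but its mean need
  not be 0. By the norm argument this mean is an integer, so subtracting that multiple of
  \<open>Phi\<close>, which x - 1 annihilates, stays inside the integer vectors.\<close>

lemma kernel_lat_diffop:
  fixes g :: "'p::nontriv R"
  assumes "prime CARD('p)" "g \<in> kernel_lat"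
  obtains h where "h \<in> kernel_lat" "g = diffop h"
proof -
  have g: "g \<in> Z_lat" "mean g = 0" "fourier 1 g = 0" using assms by (auto simp: kernel_lat_def)
  obtain h where h: "h \<in> Z_lat" "g = diffop h" using mean_eq_0_imp_diffop[OF g(1,2)] by blast
  have "zeta CARD('p) ^ 1 \<noteq> 1" using nontriv[where 'a = 'p] by (intro zeta_power_neq_1) auto
  then have f: "fourier 1 h = 0" using g(3) unfolding h(2) fourier_diffop by simp
  then have "mean h \<in> \<int>" using mean_in_Ints_if_fourier_eq_0[OF assms(1) h(1)] by simp
  then have "h - mean h *\<^sub>R Phi \<in> kernel_lat" 
    using h(1) f nontriv[where 'a = 'p]
    by (simp add: kernel_lat_def Z_lat_diff Z_lat_int_Phi)
       (simp add: fourier_perp flip: perp_def)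
  moreover have "g = diffop (h - mean h *\<^sub>R Phi)" by (simp add: diffop_diff h(2))
  ultimately show ?thesis using that by blast
qed

text \<open>The binomial expansion of \<open>(x - 1)^n\<close>, with \<open>x^k\<close> acting as a
  shift by \<open>k\<close>.\<close>

lemma funpow_diffop_nth:
  "(diffop ^^ n) g $ i = (\<Sum>k\<le>n. (-1) ^ (n - k) * real (n choose k) * g $ (i - of_nat k))"
proof (induction n arbitrary: i)
  case (Suc n)
  have "(diffop ^^ Suc n) g $ i = (diffop ^^ n) g $ (i - 1) - (diffop ^^ n) g $ i"
    by (simp add: diffop_def)
  also have "\<dots> = (\<Sum>k\<le>n. (-1) ^ (n - k) * real (n choose k) * g $ (i - of_nat (Suc k)))
      + (\<Sum>k\<le>Suc n. (-1) ^ (Suc n - k) * real (n choose k) * g $ (i - of_nat k))"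
    unfolding Suc.IH sum.atMost_Suc[of _ n] diff_conv_add_uminus[of "sum _ _" "sum _ _"] sum_negf[symmetric]
    by (simp add: Suc_diff_le algebra_simps)
  also have "\<dots> = (\<Sum>k\<le>Suc n. (-1) ^ (Suc n - k) * real (Suc n choose k) * g $ (i - of_nat k))"
    unfolding sum.atMost_Suc_shift[of _ n]
    by (simp add: sum.distrib[symmetric] algebra_simps)
  finally show ?case .
qed simp

text \<open>The inner binomial coefficients are divisible by the prime N. The two outer terms are
  the coordinates at \<open>i\<close> and at \<open>i - N\<close>, which is the same index, with
  opposite signs because N is odd.\<close>

lemma funpow_diffop_card:
  fixes g :: "'p::nontriv R"
  assumes "prime CARD('p)" "odd CARD('p)" "g \<in> Z_lat"
  obtains h where "h \<in> Z_lat" "(diffop ^^ CARD('p)) g = real CARD('p) *\<^sub>R h"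
proof
  let ?N = "CARD('p)"
  define h :: "'p R" where
    "h = (\<chi> i. \<Sum>k=1..<?N. (-1) ^ (?N - k) * real ((?N choose k) div ?N) * g $ (i - of_nat k))"
  show "h \<in> Z_lat" using assms(3) by (auto simp: h_def Z_lat_def)
  have d: "real (?N choose k) = real ?N * real ((?N choose k) div ?N)" if "k \<in> {1..<?N}" for k
  proof -
    have "?N dvd (?N choose k)" using that assms(1) by (intro dvd_choose_prime) auto
    then show ?thesis by (metis dvd_mult_div_cancel of_nat_mult)
  qed
  have "{..?N} = insert 0 (insert ?N {1..<?N})" using card_nontriv_pos[where 'p = 'p] by auto
  then have "(diffop ^^ ?N) g $ i = (real ?N *\<^sub>R h) $ i" for i
    using assms(2) unfolding funpow_diffop_nth
    by (simp add: h_def sum_distrib_left) (intro sum.cong refl, simp add: d)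
  then show "(diffop ^^ ?N) g = real ?N *\<^sub>R h" by (simp add: vec_eq_iff)
qed

lemma kernel_lat_divisible:
  fixes g :: "'p::nontriv R"
  assumes "prime CARD('p)" "odd CARD('p)" "g \<in> kernel_lat"
  obtains h where "h \<in> kernel_lat" "g = real CARD('p) *\<^sub>R h"
proof -
  have "\<exists>h\<in>kernel_lat. g = (diffop ^^ n) h" for n
  proof (induction n)
    case (Suc n)
    then obtain h where "h \<in> kernel_lat" "g = (diffop ^^ n) h" by blast
    then show ?case
      by (metis assms(1) kernel_lat_diffop funpow_Suc_right comp_apply)
  qed (use assms in auto)
  then obtain h where h: "h \<in> kernel_lat" "g = (diffop ^^ CARD('p)) h" by blast
  then obtain w where w: "w \<in> Z_lat" "g = real CARD('p) *\<^sub>R w"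
    using funpow_diffop_card[OF assms(1,2), of h] unfolding kernel_lat_def by auto
  have "w \<in> kernel_lat"
    using assms(3) w linear_scale[OF linear_mean, of "real CARD('p)" w]
    by (simp add: kernel_lat_def fourier_scaleR)
  with w that show ?thesis by blast
qed

lemma kernel_lat_trivial:
  fixes g :: "'p::nontriv R"
  assumes "prime CARD('p)" "odd CARD('p)" "g \<in> kernel_lat"
  shows "g = 0"
proof -
  have ex: "\<exists>h\<in>kernel_lat. g = (real CARD('p) ^ n) *\<^sub>R h" for n
  proof (induction n)
    case (Suc n)
    then obtain h where "h \<in> kernel_lat" "g = (real CARD('p) ^ n) *\<^sub>R h" by blast
    moreover then obtain h' where "h' \<in> kernel_lat" "h = real CARD('p) *\<^sub>R h'"
      using kernel_lat_divisible[OF assms(1,2)] by blast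
    ultimately show ?case by (auto simp: mult.commute)
  qed (use assms in auto)
  have "g $ i = 0" for i
  proof -
    have "1 < real CARD('p)" using nontriv[where 'a = 'p] by simp
    then obtain n where n: "\<bar>g $ i\<bar> < real CARD('p) ^ n" using real_arch_pow by blast
    obtain h where "h \<in> kernel_lat" "g = (real CARD('p) ^ n) *\<^sub>R h" using ex by blast
    then have h: "g $ i = real CARD('p) ^ n * h $ i" "h $ i \<in> \<int>" by (auto simp: kernel_lat_def Z_lat_def)
    have "\<bar>h $ i\<bar> < 1"
      using n unfolding h(1) abs_mult by (simp add: mult_less_cancel_left1)
    then have "h $ i = 0" using h(2) Ints_nonzero_abs_less1 by blast
    then show ?thesis by (simp add: h(1))
  qed
  then show ?thesis by (simp add: vec_eq_iff)
qed

text \<open>This is the irreducibility of the cyclotomic polynomial in the form used below: an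
  integer relation between the powers of \<zeta> is a multiple of the relation given by
  \<open>Phi\<close>.\<close>

lemma perp_eq_0_if_fourier_eq_0:
  fixes g :: "'p::nontriv R"
  assumes "prime CARD('p)" "odd CARD('p)" "g \<in> Z_lat" "fourier 1 g = 0"
  shows "perp g = 0"
proof (rule kernel_lat_trivial[OF assms(1,2)])
  have "mean g \<in> \<int>" using mean_in_Ints_if_fourier_eq_0 assms by blast
  then show "perp g \<in> kernel_lat" 
    using assms(3,4) nontriv[where 'a = 'p]
    by (simp add: kernel_lat_def fourier_perp) (simp add: perp_def Z_lat_diff Z_lat_int_Phi)
qed

section \<open>The cyclotomic integers inside \<open>R_perp\<close>\<close>

declare One_nat_def [simp del]

definition coeff_vec :: "(nat \<Rightarrow> int) \<Rightarrow> 'p::nontriv R" where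
  "coeff_vec c = (\<chi> i. of_int (c (nat (to_int_mod_ring i))))"

lemma coeff_vec_in_Z_lat [simp]: "coeff_vec c \<in> Z_lat"
  by (simp add: coeff_vec_def Z_lat_def)

lemma coeff_vec_of_nat: "k < CARD('p) \<Longrightarrow> (coeff_vec c :: 'p::nontriv R) $ of_nat k = of_int (c k)"
  by (simp add: coeff_vec_def to_int_mod_ring_of_nat)

lemma coeff_vec_0 [simp]: "(coeff_vec c :: 'p::nontriv R) $ 0 = of_int (c 0)"
  using coeff_vec_of_nat[of 0 c, where 'p = 'p] by simp

lemma fourier_coeff_vec:
  assumes "c 0 = 0"
  shows "fourier j (coeff_vec c :: 'p::nontriv R) = (\<Sum>k=1..<CARD('p). of_int (c k) * zeta CARD('p) ^ (j * k))"
proof -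
  have "{..<CARD('p)} = insert 0 {1..<CARD('p)}" using card_nontriv_pos[where 'p = 'p] by auto
  with assms show ?thesis
    unfolding fourier_def
    by (simp add: coeff_vec_of_nat)
qed

text \<open>All powers of \<zeta> sum to 0, so subtracting the multiple \<open>z $ 0\<close> of
  \<open>Phi\<close> removes the coefficient of 1 without changing the components of nonzero
  index.\<close>

lemma fourier_eq_coeff_vec:
  fixes z :: "'p::nontriv R"
  assumes "z \<in> Z_lat"
  obtains c where "\<And>k. k \<notin> {1..<CARD('p)} \<Longrightarrow> c k = 0" 
    "\<And>j. 0 < j \<Longrightarrow> j < CARD('p) \<Longrightarrow> fourier j z = fourier j (coeff_vec c :: 'p R)"
proof
  define c where "c k = (if k \<in> {1..<CARD('p)} then \<lfloor>z $ of_nat k - z $ 0\<rfloor> else 0)" for k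
  show "c k = 0" if "k \<notin> {1..<CARD('p)}" for k using that unfolding c_def by (rule if_not_P)
  have "(coeff_vec c :: 'p R) $ i = (z - z $ 0 *\<^sub>R Phi) $ i" for i
  proof -
    obtain k where k: "k < CARD('p)" "i = of_nat k" by (metis mod_ring_eq_of_nat)
    have "z $ i - z $ 0 \<in> \<int>" using assms by (simp add: Z_lat_def)
    with k show ?thesis
      by (cases "k = 0") (auto simp: coeff_vec_of_nat c_def Phi_def elim: Ints_cases)
  qed
  then have "coeff_vec c = z - z $ 0 *\<^sub>R Phi" by (intro vec_eq_iff[THEN iffD2] allI)
  then show "fourier j z = fourier j (coeff_vec c :: 'p R)" if "0 < j" "j < CARD('p)" for j
    using that by (simp add: fourier_diff fourier_scaleR fourier_Phi)
qed

text \<open>Evaluation at \<zeta> maps the integer vectors onto O. From here on an element of O is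
  handled through an integer lift, which is unique up to multiples of \<open>Phi\<close>.\<close>

lemma cyc_int_eq: "cyc_int CARD('p) = fourier 1 ` (Z_lat :: 'p::nontriv R set)"
proof (intro equalityI subsetI)
  fix \<gamma> assume "\<gamma> \<in> cyc_int CARD('p)"
  then obtain c :: "nat \<Rightarrow> int" where "\<gamma> = (\<Sum>k=1..<CARD('p). of_int (c k) * zeta CARD('p) ^ k)"
    unfolding cyc_int_def by blast
  then have "\<gamma> = fourier 1 (coeff_vec (c(0 := 0)) :: 'p R)"
    by (subst fourier_coeff_vec) auto
  then show "\<gamma> \<in> fourier 1 ` (Z_lat :: 'p R set)" by auto
next
  fix \<gamma> assume "\<gamma> \<in> fourier 1 ` (Z_lat :: 'p R set)"
  then obtain z :: "'p R" where z: "z \<in> Z_lat" "\<gamma> = fourier 1 z" by blast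
  obtain c where c: "\<And>k. k \<notin> {1..<CARD('p)} \<Longrightarrow> c k = 0" 
    "\<And>j. 0 < j \<Longrightarrow> j < CARD('p) \<Longrightarrow> fourier j z = fourier j (coeff_vec c :: 'p R)"
    using fourier_eq_coeff_vec[OF z(1)] by blast
  have "\<gamma> = (\<Sum>k=1..<CARD('p). of_int (c k) * zeta CARD('p) ^ k)"
    using nontriv[where 'a = 'p] c fourier_coeff_vec[of c 1, where 'p = 'p] z(2) by simp
  then show "\<gamma> \<in> cyc_int CARD('p)" unfolding cyc_int_def by blast
qed

section \<open>Conjugates and the embedding of O computed on integer lifts\<close>

context
  fixes ty :: "'p::nontriv itself"
  assumes prime_card: "prime CARD('p)" and odd_card: "odd CARD('p)"
begin

lemma fourier_1_eq_imp_perp_eq: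
  fixes u v :: "'p R"
  assumes "u \<in> Z_lat" "v \<in> Z_lat" "fourier 1 u = fourier 1 v"
  shows "perp u = perp v"
proof -
  have "perp (u - v) = 0"
    using assms prime_card odd_card by (intro perp_eq_0_if_fourier_eq_0) (auto simp: Z_lat_diff fourier_diff)
  then show ?thesis by (simp add: linear_diff[OF linear_perp])
qed

lemma cyc_coeff_eq:
  assumes "\<And>k. k \<notin> {1..<CARD('p)} \<Longrightarrow> c k = 0"
  shows "cyc_coeff CARD('p) (fourier 1 (coeff_vec c :: 'p R)) = c"
  unfolding cyc_coeff_def
proof (rule the_equality)
  have c0: "c 0 = 0" using assms by simp
  show "(\<forall>k. k \<notin> {1..<CARD('p)} \<longrightarrow> c k = 0) \<and>
      fourier 1 (coeff_vec c :: 'p R) = (\<Sum>k = 1..<CARD('p). of_int (c k) * zeta CARD('p) ^ k)"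
    using assms fourier_coeff_vec[of c 1, OF c0, where 'p = 'p] by simp
  fix d assume d: "(\<forall>k. k \<notin> {1..<CARD('p)} \<longrightarrow> d k = 0) \<and>
      fourier 1 (coeff_vec c :: 'p R) = (\<Sum>k = 1..<CARD('p). of_int (d k) * zeta CARD('p) ^ k)"
  then have d0: "d 0 = 0" by simp
  have "fourier 1 (coeff_vec d :: 'p R) = fourier 1 (coeff_vec c :: 'p R)"
    using d fourier_coeff_vec[of d 1, OF d0, where 'p = 'p] by simp
  then have "perp (coeff_vec d :: 'p R) = perp (coeff_vec c)"
    by (intro fourier_1_eq_imp_perp_eq) simp_all
  then have eq: "(coeff_vec d :: 'p R) $ i - mean (coeff_vec d :: 'p R) = coeff_vec c $ i - mean (coeff_vec c :: 'p R)" for i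
    by (metis perp_nth)
  \<comment> \<open>The two vectors differ by a multiple of \<open>Phi\<close>; both have coordinate
    0 at index 0, so this multiple is zero.\<close>
  have "mean (coeff_vec d :: 'p R) = mean (coeff_vec c :: 'p R)"
    using eq[of 0] c0 d0 by simp
  with eq have "d k = c k" if "k < CARD('p)" for k
    using eq[of "of_nat k"] by (simp add: coeff_vec_of_nat[OF that])
  moreover have "d k = c k" if "\<not> k < CARD('p)" for k using that d assms by simp
  ultimately show "d = c" by blast
qed

lemma galois_fourier:
  fixes z :: "'p R"
  assumes "z \<in> Z_lat" "0 < j" "j < CARD('p)"
  shows "galois CARD('p) j (fourier 1 z) = fourier j z"
proof -
  obtain c where c: "\<And>k. k \<notin> {1..<CARD('p)} \<Longrightarrow> c k = 0" 
    "\<And>j. 0 < j \<Longrightarrow> j < CARD('p) \<Longrightarrow> fourier j z = fourier j (coeff_vec c :: 'p R)"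
    using fourier_eq_coeff_vec[OF assms(1)] by blast
  have "fourier 1 z = fourier 1 (coeff_vec c :: 'p R)" using c(2) nontriv[where 'a = 'p] by simp
  then show ?thesis
    unfolding galois_def using c(2)[OF assms(2,3)] cyc_coeff_eq[of c] c(1) fourier_coeff_vec[of c j, where 'p = 'p]
    by simp
qed

text \<open>Replaces the description in \<open>iota\<close> by an orthogonal projection of any
  integer lift. Uniqueness holds because the components of nonzero index determine a vector of
  \<open>R_perp\<close>.\<close>

lemma iota_fourier:
  fixes z :: "'p R"
  assumes "z \<in> Z_lat"
  shows "iota (fourier 1 z) = perp z"
  unfolding iota_def
proof (rule the_equality)
  have j: "0 < j" "j < CARD('p)" if "j \<in> {1..<CARD('p)}" for j using that by auto
  show "perp z \<in> R_perp \<and> (\<forall>j\<in>{1..<CARD('p)}. fourier j (perp z) = galois CARD('p) j (fourier 1 z))"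
    by (metis galois_fourier[OF assms j] fourier_perp[OF j] perp_in_R_perp)
  fix v :: "'p R"
  assume v: "v \<in> R_perp \<and> (\<forall>j\<in>{1..<CARD('p)}. fourier j v = galois CARD('p) j (fourier 1 z))"
  have "perp v = perp z"
  proof (rule perp_inject)
    fix j assume j: "0 < j" "j < CARD('p)"
    then have "j \<in> {1..<CARD('p)}" by auto
    with v show "fourier j v = fourier j z" using galois_fourier[OF assms j] by metis
  qed
  with v show "v = perp z" by (simp add: perp_ident)
qed

lemma iota_cyc_int: "iota ` cyc_int CARD('p) = perp ` (Z_lat :: 'p R set)"
  unfolding cyc_int_eq image_image by (intro image_cong refl iota_fourier)

text \<open>A vanishing component \<open>j\<close> could be moved to index 1 by a Galois
  automorphism. The conjugate of \<open>b\<close> would then be a multiple of \<open>Phi\<close>,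
  and so would \<open>b\<close>, since coordinate permutations fix \<open>Phi\<close>.\<close>

lemma fourier_nonzero:
  fixes b :: "'p R"
  assumes "b \<in> Z_lat" "fourier 1 b \<noteq> 0" "0 < j" "j < CARD('p)"
  shows "fourier j b \<noteq> 0"
proof
  assume 0: "fourier j b = 0"
  obtain a where a: "(j * a) mod CARD('p) = 1" using ex_inverse_mod prime_card assms by blast
  then have a': "(a * j) mod CARD('p) = 1" by (simp add: mult.commute)
  have "fourier 1 (dilate a b) = 0" unfolding fourier_dilate[OF a'] using 0 by simp
  then have "perp (dilate a b) = 0"
    using assms prime_card odd_card by (intro perp_eq_0_if_fourier_eq_0) (auto simp: Z_lat_dilate)
  then obtain m where "dilate a b = m *\<^sub>R Phi" by (auto simp: perp_def)
  then have "dilate j (dilate a b) = m *\<^sub>R Phi"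
    by (simp add: vec_eq_iff dilate_def[of j] Phi_def)
  then have "b = m *\<^sub>R Phi" unfolding dilate_dilate[OF a] .
  then have "fourier 1 b = 0" using nontriv[where 'a = 'p] by (simp add: fourier_scaleR fourier_Phi)
  then show False using assms(2) by simp
qed

end

text \<open>Multiplication by \<open>b\<close> on \<open>R_perp\<close>, extended by the identity on the line through \<open>Phi\<close>.\<close>

definition mult_perp :: "'p::nontriv R \<Rightarrow> 'p R \<Rightarrow> 'p R" where
  "mult_perp b v = conv b (perp v) + mean v *\<^sub>R Phi"

lemma linear_conv: "linear (conv b)"
  by (rule linearI) (simp_all add: conv_def vec_eq_iff distrib_left sum.distrib sum_distrib_left mult.left_commute)

lemma linear_mult_perp: "linear (mult_perp b)"
  by (rule linearI)
     (simp_all add: mult_perp_def linear_add[OF linear_perp] linear_add[OF linear_conv] linear_add[OF linear_mean]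
       linear_scale[OF linear_perp] linear_scale[OF linear_conv] linear_scale[OF linear_mean] algebra_simps)

lemma mean_conv: "mean (conv a v) = real CARD('p) * mean a * mean (v :: 'p::nontriv R)"
proof -
  have "real CARD('p) * mean (conv a v) = real CARD('p) * mean a * (real CARD('p) * mean v)"
    using fourier_conv[of 0 a v] unfolding fourier_0_mean by (metis of_real_eq_iff of_real_mult)
  then show ?thesis by simp
qed

lemma mean_mult_perp [simp]: "mean (mult_perp b v) = mean v"
  by (simp add: mult_perp_def linear_add[OF linear_mean] linear_scale[OF linear_mean] mean_conv)

lemma fourier_mult_perp:
  "0 < j \<Longrightarrow> j < CARD('p) \<Longrightarrow> fourier j (mult_perp b v) = fourier j b * fourier j (v :: 'p::nontriv R)"
  by (simp add: mult_perp_def fourier_add fourier_scaleR fourier_Phi fourier_conv fourier_perp)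

lemma perp_mult_perp: "perp (mult_perp b v) = mult_perp b (perp v)"
proof -
  have "perp (mult_perp b v) = perp (mult_perp b (perp v))"
    by (rule perp_inject) (simp add: fourier_mult_perp fourier_perp)
  also have "\<dots> = mult_perp b (perp v)" by (rule perp_ident) (simp add: R_perp_iff)
  finally show ?thesis .
qed

text \<open>The ring product and \<open>mult_perp\<close> treat the direction \<open>Phi\<close>
  differently, but agree after projection. So products of integer lifts, which stay integral,
  describe \<open>mult_perp\<close> on the projected lattice.\<close>

lemma perp_conv: "perp (conv b v) = mult_perp b (perp v)"
  unfolding perp_mult_perp[symmetric] by (rule perp_inject) (simp add: fourier_mult_perp fourier_conv)

context
  fixes b :: "'p::nontriv R"
  assumes prime_card: "prime CARD('p)" and odd_card: "odd CARD('p)"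
    and b: "b \<in> Z_lat" "fourier 1 b \<noteq> 0"
begin

lemma bij_mult_perp: "bij (mult_perp b)"
proof -
  have "inj (mult_perp b)"
  proof (rule injI)
    fix u v assume eq: "mult_perp b u = mult_perp b v"
    then have m: "mean u = mean v" by (metis mean_mult_perp)
    have "perp u = perp v"
    proof (rule perp_inject)
      fix j assume j: "0 < j" "j < CARD('p)"
      then show "fourier j u = fourier j v"
        using eq fourier_nonzero[OF prime_card odd_card b j] by (metis fourier_mult_perp mult_left_cancel)
    qed
    with m show "u = v" by (simp add: perp_def)
  qed
  then show ?thesis
    using linear_injective_imp_surjective[OF linear_mult_perp] by (simp add: bij_def)
qed

text \<open>Writing the message point as \<open>mult_perp b v\<close> turns the division defining
  \<open>u_div\<close> into a projection of \<open>v\<close>.\<close>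

lemma u_div_eq: "u_div (fourier 1 b) (mult_perp b v) = perp v"
  unfolding u_div_def
proof (rule the_equality)
  have nz: "fourier j b \<noteq> 0" if "0 < j" "j < CARD('p)" for j
    using fourier_nonzero[OF prime_card odd_card b that] .
  show "perp v \<in> R_perp \<and> (\<forall>j\<in>{1..<CARD('p)}.
      fourier j (perp v) = fourier j (mult_perp b v) / galois CARD('p) j (fourier 1 b))"
  proof (intro conjI ballI perp_in_R_perp)
    fix j assume "j \<in> {1..<CARD('p)}"
    then have j: "0 < j" "j < CARD('p)" by auto
    show "fourier j (perp v) = fourier j (mult_perp b v) / galois CARD('p) j (fourier 1 b)"
      unfolding fourier_perp[OF j] fourier_mult_perp[OF j] galois_fourier[OF prime_card odd_card b(1) j]
      using nz[OF j] by simp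
  qed
  fix u :: "'p R"
  assume u: "u \<in> R_perp \<and> (\<forall>j\<in>{1..<CARD('p)}.
      fourier j u = fourier j (mult_perp b v) / galois CARD('p) j (fourier 1 b))"
  have "perp u = perp v"
  proof (rule perp_inject)
    fix j assume j: "0 < j" "j < CARD('p)"
    then have "j \<in> {1..<CARD('p)}" by auto
    with u have "fourier j u = fourier j (mult_perp b v) / galois CARD('p) j (fourier 1 b)" by blast
    then show "fourier j u = fourier j v"
      unfolding fourier_mult_perp[OF j] galois_fourier[OF prime_card odd_card b(1) j]
      using nz[OF j] by simp
  qed
  with u show "u = perp v" by (simp add: perp_ident)
qed

lemma fourier_1_mult_cyc_int_iff:
  assumes "l \<in> Z_lat" "g \<in> Z_lat"
  shows "fourier 1 l = fourier 1 b * fourier 1 g \<longleftrightarrow> perp l = mult_perp b (perp g)"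
proof
  assume "fourier 1 l = fourier 1 b * fourier 1 g"
  then have "perp l = perp (conv b g)"
    using assms b by (intro fourier_1_eq_imp_perp_eq[OF prime_card odd_card]) (simp_all add: fourier_conv Z_lat_conv)
  then show "perp l = mult_perp b (perp g)" by (simp add: perp_conv)
next
  assume eq: "perp l = mult_perp b (perp g)"
  have 1: "0 < (1::nat)" "1 < CARD('p)" by (simp_all add: nontriv)
  from eq have "fourier 1 (perp l) = fourier 1 (mult_perp b (perp g))" by simp
  then show "fourier 1 l = fourier 1 b * fourier 1 g"
    unfolding fourier_mult_perp[OF 1] fourier_perp[OF 1] .
qed

text \<open>Turns divisibility by \<beta> into a condition on the projection alone; along
  \<open>Phi\<close> only integrality remains.\<close>

lemma L_lat_iff:
  "l \<in> L_lat (fourier 1 b) \<longleftrightarrow> l \<in> Z_lat \<and> (\<exists>g\<in>Z_lat. perp l = mult_perp b (perp g))"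
proof -
  have "(\<Sum>k<CARD('p). of_real (l $ of_nat k) * zeta CARD('p) ^ k) = fourier 1 l"
    by (simp add: fourier_def)
  then show ?thesis
    unfolding L_lat_def cyc_int_eq[where 'p = 'p] image_image image_iff mem_Collect_eq
    by (auto simp: fourier_1_mult_cyc_int_iff)
qed

end

section \<open>Integration over fundamental domains\<close>

text \<open>Unfolding: \<open>\<phi>\<close> is almost everywhere the sum over the lattice of the
  translates of \<open>h\<close> cut off to \<open>W\<close>. Exchanging sum and integral and
  translating each term moves the lattice sum onto the indicator of \<open>D\<close>, where it
  equals 1. Measurability of \<open>\<phi>\<close> is a conclusion here, in the form of an almost
  everywhere equal \<open>\<psi>\<close>.\<close>

lemma nn_integral_fundamental_domain:
  fixes M :: "'a::ab_group_add measure" and h \<phi> :: "'a \<Rightarrow> ennreal"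
  assumes \<Lambda>: "countable \<Lambda>" "\<And>l. l \<in> \<Lambda> \<Longrightarrow> - l \<in> \<Lambda>"
    and meas: "\<And>l. l \<in> \<Lambda> \<Longrightarrow> (\<lambda>x. x + l) \<in> measurable M M"
    and inv: "\<And>l. l \<in> \<Lambda> \<Longrightarrow> distr M M (\<lambda>x. x + l) = M"
    and D: "fundamental_domain M \<Lambda> D" and W: "fundamental_domain M \<Lambda> W"
    and h: "h \<in> borel_measurable M"
    and \<phi>: "\<And>x l. x \<in> space M \<Longrightarrow> l \<in> \<Lambda> \<Longrightarrow> x - l \<in> W \<Longrightarrow> \<phi> x = h (x - l)"
  shows "(\<integral>\<^sup>+x\<in>D. \<phi> x \<partial>M) = (\<integral>\<^sup>+x\<in>W. h x \<partial>M)"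
    and "\<exists>\<psi>\<in>borel_measurable M. AE x in M. \<phi> x = \<psi> x"
proof -
  have D': "D \<in> sets M" "AE x in M. \<exists>!l. l \<in> \<Lambda> \<and> x - l \<in> D"
    and W': "W \<in> sets M" "AE x in M. \<exists>!l. l \<in> \<Lambda> \<and> x - l \<in> W"
    using D W by (auto simp: fundamental_domain_def)
  note [measurable] = D'(1) W'(1) h
  have meas' [measurable]: "(\<lambda>x. x - l) \<in> measurable M M" if "l \<in> \<Lambda>" for l
    using meas[OF \<Lambda>(2)[OF that]] by simp
  define \<psi> where "\<psi> x = (\<integral>\<^sup>+l. h (x - l) * indicator W (x - l) \<partial>count_space \<Lambda>)" for x
  have single: "(\<integral>\<^sup>+l. g l \<partial>count_space \<Lambda>) = g k"
    if "k \<in> \<Lambda>" "\<And>l. l \<in> \<Lambda> \<Longrightarrow> l \<noteq> k \<Longrightarrow> g l = 0" for g :: "'a \<Rightarrow> ennreal" and k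
  proof -
    have "(\<integral>\<^sup>+l. g l \<partial>count_space \<Lambda>) = (\<integral>\<^sup>+l. g k * indicator {k} l \<partial>count_space \<Lambda>)"
      using that by (intro nn_integral_cong) (auto split: split_indicator)
    also have "\<dots> = g k" using that(1) by (simp add: nn_integral_cmult_indicator)
    finally show ?thesis .
  qed
  have \<psi>_meas: "\<psi> \<in> borel_measurable M"
  proof -
    interpret sigma_finite_measure "count_space \<Lambda>"
      using \<Lambda>(1) by (rule sigma_finite_measure_count_space_countable)
    show ?thesis
      unfolding \<psi>_def
      by (rule borel_measurable_nn_integral, unfold case_prod_beta,
          rule measurable_compose_countable'[where f = "\<lambda>l p. h (fst p - l) * indicator W (fst p - l)" and g = snd, OF _ _ \<Lambda>(1)])
         measurable
  qed
  have \<phi>\<psi>: "AE x in M. \<phi> x = \<psi> x"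
    using W'(2) AE_space
  proof eventually_elim
    case (elim x)
    then obtain k where k: "k \<in> \<Lambda>" "x - k \<in> W" "\<And>l. l \<in> \<Lambda> \<Longrightarrow> x - l \<in> W \<Longrightarrow> l = k" by blast
    have "\<psi> x = h (x - k) * indicator W (x - k)"
      unfolding \<psi>_def by (rule single[OF k(1)]) (metis k(3) indicator_simps(2) mult_zero_right)
    with k(2) \<phi>[OF elim(2) k(1,2)] show ?case by simp
  qed
  then show "\<exists>\<psi>\<in>borel_measurable M. AE x in M. \<phi> x = \<psi> x" using \<psi>_meas by blast
  have "(\<integral>\<^sup>+x\<in>D. \<phi> x \<partial>M) = (\<integral>\<^sup>+x. \<psi> x * indicator D x \<partial>M)"
    using \<phi>\<psi> by (intro nn_integral_cong_AE) auto
  also have "\<dots> = (\<integral>\<^sup>+x. \<integral>\<^sup>+l. h (x - l) * indicator W (x - l) * indicator D x \<partial>count_space \<Lambda> \<partial>M)"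
    unfolding \<psi>_def by (simp add: nn_integral_multc)
  also have "\<dots> = (\<integral>\<^sup>+l. \<integral>\<^sup>+x. h (x - l) * indicator W (x - l) * indicator D x \<partial>M \<partial>count_space \<Lambda>)"
    using \<Lambda>(1) by (intro nn_integral_count_space_nn_integral) measurable
  \<comment> \<open>Substitution of \<open>x + l\<close> for \<open>x\<close> in each term, by
    invariance of the measure.\<close>
  also have "\<dots> = (\<integral>\<^sup>+l. \<integral>\<^sup>+x. h x * indicator W x * indicator D (x + l) \<partial>M \<partial>count_space \<Lambda>)"
  proof (rule nn_integral_cong)
    fix l assume "l \<in> space (count_space \<Lambda>)"
    then have l [measurable]: "l \<in> \<Lambda>" by simp
    note [measurable] = meas[OF l] meas'[OF l]
    have "(\<integral>\<^sup>+x. h (x - l) * indicator W (x - l) * indicator D x \<partial>M)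
        = (\<integral>\<^sup>+x. h (x - l) * indicator W (x - l) * indicator D x \<partial>distr M M (\<lambda>x. x + l))"
      by (simp add: inv[OF l])
    also have "\<dots> = (\<integral>\<^sup>+x. h x * indicator W x * indicator D (x + l) \<partial>M)"
      by (subst nn_integral_distr) simp_all
    finally show "(\<integral>\<^sup>+x. h (x - l) * indicator W (x - l) * indicator D x \<partial>M)
        = (\<integral>\<^sup>+x. h x * indicator W x * indicator D (x + l) \<partial>M)" .
  qed
  also have "\<dots> = (\<integral>\<^sup>+x. \<integral>\<^sup>+l. h x * indicator W x * indicator D (x + l) \<partial>count_space \<Lambda> \<partial>M)"
    using \<Lambda>(1) meas by (intro nn_integral_count_space_nn_integral[symmetric]) measurable
  also have "\<dots> = (\<integral>\<^sup>+x\<in>W. h x \<partial>M)"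
  proof (rule nn_integral_cong_AE)
    show "AE x in M. (\<integral>\<^sup>+l. h x * indicator W x * indicator D (x + l) \<partial>count_space \<Lambda>) = h x * indicator W x"
      using D'(2)
    proof eventually_elim
      case (elim x)
      then obtain k where k: "k \<in> \<Lambda>" "x - k \<in> D" "\<And>l. l \<in> \<Lambda> \<Longrightarrow> x - l \<in> D \<Longrightarrow> l = k" by blast
      \<comment> \<open>The sum runs over \<open>x + l\<close> while the domain property speaks of
        \<open>x - l\<close>, so the one surviving index is \<open>- k\<close>.\<close>
      have "l = - k" if "l \<in> \<Lambda>" "x + l \<in> D" for l
        using k(3)[of "- l"] \<Lambda>(2) that by auto
      then have "(\<integral>\<^sup>+l. h x * indicator W x * indicator D (x + l) \<partial>count_space \<Lambda>)
          = h x * indicator W x * indicator D (x + - k)"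
        by (intro single[OF \<Lambda>(2)[OF k(1)]]) (metis indicator_simps(2) mult_zero_right)
      with k(2) show ?case by simp
    qed
  qed
  finally show "(\<integral>\<^sup>+x\<in>D. \<phi> x \<partial>M) = (\<integral>\<^sup>+x\<in>W. h x \<partial>M)" .
qed

text \<open>Preimages under \<open>f\<close> and \<open>g\<close> differ by null sets, which the
  completion contains. This makes errors measurable that depend on arbitrary choices on
  ties.\<close>

lemma borel_measurable_completion_AE:
  fixes f g :: "'a \<Rightarrow> 'b::topological_space"
  assumes "f \<in> borel_measurable (completion M)" "AE x in completion M. f x = g x"
  shows "g \<in> borel_measurable (completion M)"
proof (rule measurableI)
  fix A :: "'b set" assume A: "A \<in> sets borel"
  show "g -` A \<inter> space (completion M) \<in> sets (completion M)"
  proof (rule completion.in_sets_AE)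
    show "f -` A \<inter> space (completion M) \<in> sets (completion M)" using assms(1) A by (rule measurable_sets)
    show "AE x in completion M. x \<in> f -` A \<inter> space (completion M) \<longleftrightarrow> x \<in> g -` A \<inter> space (completion M)"
      using assms(2) by eventually_elim auto
  qed auto
qed simp

lemma translation_invariant_completion:
  fixes M :: "'a::ab_group_add measure"
  assumes "(\<lambda>x. x + l) \<in> measurable M M" "distr M M (\<lambda>x. x + l) = M"
  shows "(\<lambda>x. x + l) \<in> measurable (completion M) (completion M)"
    and "distr (completion M) (completion M) (\<lambda>x. x + l) = completion M"
proof -
  have X: "(\<lambda>x. x + l) \<in> measurable (completion M) M" using assms(1) by (rule measurable_completion)
  have d: "distr (completion M) M (\<lambda>x. x + l) = M" using distr_completion[OF assms(1)] assms(2) by simp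
  show "(\<lambda>x. x + l) \<in> measurable (completion M) (completion M)"
    by (rule completion.measurable_completion2[OF X]) (simp add: d)
  show "distr (completion M) (completion M) (\<lambda>x. x + l) = completion M"
    using completion.completion_distr_eq[OF X] by (simp add: d)
qed

text \<open>\<open>D\<close> is measurable only for the completion, whereas \<open>W\<close> and
  \<open>h\<close> live on \<open>M\<close>, where the explicit integrals are computed.\<close>

lemma integral_uniform_measure_fundamental_domain:
  fixes M :: "'a::ab_group_add measure" and h \<phi> :: "'a \<Rightarrow> real"
  assumes \<Lambda>: "countable \<Lambda>" "\<And>l. l \<in> \<Lambda> \<Longrightarrow> - l \<in> \<Lambda>"
    and meas: "\<And>l. l \<in> \<Lambda> \<Longrightarrow> (\<lambda>x. x + l) \<in> measurable M M"
    and inv: "\<And>l. l \<in> \<Lambda> \<Longrightarrow> distr M M (\<lambda>x. x + l) = M"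
    and D: "fundamental_domain (completion M) \<Lambda> D" and W: "fundamental_domain M \<Lambda> W"
    and W': "emeasure M W = ennreal w" "0 < w"
    and h: "h \<in> borel_measurable M" "\<And>x. 0 \<le> h x" "(\<integral>\<^sup>+x\<in>W. h x \<partial>M) = ennreal r" "0 \<le> r"
    and \<phi>: "\<And>x. 0 \<le> \<phi> x" "\<And>x l. x \<in> space M \<Longrightarrow> l \<in> \<Lambda> \<Longrightarrow> x - l \<in> W \<Longrightarrow> \<phi> x = h (x - l)"
  shows "(\<integral>x. \<phi> x \<partial>uniform_measure (completion M) D) = r / w"
proof -
  let ?C = "completion M"
  have WC: "fundamental_domain ?C \<Lambda> W"
    using W by (auto simp: fundamental_domain_def AE_completion)
  have DC: "D \<in> sets ?C" using D by (simp add: fundamental_domain_def)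
  have WM: "W \<in> sets M" using W by (simp add: fundamental_domain_def)
  have meas_C: "(\<lambda>x. x + l) \<in> measurable ?C ?C" and inv_C: "distr ?C ?C (\<lambda>x. x + l) = ?C" if "l \<in> \<Lambda>" for l
    using translation_invariant_completion meas inv that by blast+
  have hC: "(\<lambda>x. ennreal (h x)) \<in> borel_measurable ?C" using h(1) by (intro measurable_completion) simp
  note fd = nn_integral_fundamental_domain[OF \<Lambda> meas_C inv_C D WC]
  \<comment> \<open>The unfolding applied to the constant 1: all fundamental domains have the same
    volume.\<close>
  have "emeasure ?C D = emeasure ?C W"
    using fd(1)[of "\<lambda>_. 1" "\<lambda>_. 1"] DC WM by simp
  then have eD: "emeasure ?C D = ennreal w" using W' WM by simp
  have int: "(\<integral>\<^sup>+x\<in>D. \<phi> x \<partial>?C) = ennreal r"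
    using fd(1)[OF _ _ _ hC, of "\<lambda>x. ennreal (\<phi> x)"] \<phi> h(3) by (simp add: nn_integral_completion)
  obtain \<psi> where \<psi>: "\<psi> \<in> borel_measurable ?C" "AE x in ?C. ennreal (\<phi> x) = \<psi> x"
    using fd(2)[OF _ _ _ hC, of "\<lambda>x. ennreal (\<phi> x)"] \<phi> by auto
  have "(\<lambda>x. enn2real (\<psi> x)) \<in> borel_measurable ?C" using \<psi>(1) by simp
  moreover have "AE x in ?C. enn2real (\<psi> x) = \<phi> x" using \<psi>(2) by eventually_elim (metis \<phi>(1) enn2real_ennreal)
  ultimately have m: "\<phi> \<in> borel_measurable ?C" by (rule borel_measurable_completion_AE)
  have "(\<integral>x. \<phi> x \<partial>uniform_measure ?C D) = enn2real (\<integral>\<^sup>+x. \<phi> x \<partial>uniform_measure ?C D)"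
    using m \<phi>(1) by (intro integral_eq_nn_integral) auto
  also have "\<dots> = enn2real (ennreal r / ennreal w)"
    using m DC int by (simp add: nn_integral_uniform_measure eD)
  finally show ?thesis using h(4) W'(2) by (simp add: divide_ennreal)
qed

section \<open>Change of variables by translations and linear bijections\<close>

lemma nn_integral_lborel_translate:
  fixes f :: "'a::euclidean_space \<Rightarrow> ennreal"
  assumes [measurable]: "f \<in> borel_measurable borel"
  shows "(\<integral>\<^sup>+x. f (x + a) \<partial>lborel) = (\<integral>\<^sup>+x. f x \<partial>lborel)"
proof -
  have "(\<integral>\<^sup>+x. f x \<partial>lborel) = (\<integral>\<^sup>+x. f x \<partial>distr lborel borel ((+) a))"
    by (simp add: lborel_distr_plus)
  also have "\<dots> = (\<integral>\<^sup>+x. f (x + a) \<partial>lborel)"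
    by (subst nn_integral_distr) (simp_all add: add.commute)
  finally show ?thesis by simp
qed

text \<open>
  The argument for uniqueness of Haar measure: comparing the integrals through an auxiliary set
  \<open>B\<close> avoids determinants.
\<close>

lemma nn_integral_linear_bij:
  fixes f :: "'a::euclidean_space \<Rightarrow> ennreal" and T :: "'a \<Rightarrow> 'a"
  assumes T: "linear T" "bij T"
    and [measurable]: "f \<in> borel_measurable borel" "B \<in> sets borel"
  shows "emeasure lborel B * (\<integral>\<^sup>+x. f (T x) \<partial>lborel)
    = emeasure lborel {x. - T x \<in> B} * (\<integral>\<^sup>+x. f x \<partial>lborel)"
proof -
  have [measurable]: "T \<in> borel_measurable borel"
    by (intro borel_measurable_continuous_onI linear_continuous_on) (use T linear_conv_bounded_linear in blast)
  have "emeasure lborel B * (\<integral>\<^sup>+x. f (T x) \<partial>lborel) = (\<integral>\<^sup>+x. f (T x) * emeasure lborel B \<partial>lborel)"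
    by (subst nn_integral_multc) (simp_all add: mult.commute)
  also have "\<dots> = (\<integral>\<^sup>+x. \<integral>\<^sup>+y. f (T x) * indicator B (y - T x) \<partial>lborel \<partial>lborel)"
  proof (rule nn_integral_cong)
    fix x
    have "(\<integral>\<^sup>+y. f (T x) * indicator B (y - T x) \<partial>lborel) = f (T x) * (\<integral>\<^sup>+y. indicator B (y + - T x) \<partial>lborel)"
      by (simp add: nn_integral_cmult)
    also have "(\<integral>\<^sup>+y. indicator B (y + - T x) \<partial>lborel) = (\<integral>\<^sup>+y. indicator B y \<partial>lborel)"
      by (rule nn_integral_lborel_translate) simp
    finally show "f (T x) * emeasure lborel B = (\<integral>\<^sup>+y. f (T x) * indicator B (y - T x) \<partial>lborel)" by simp
  qed
  also have "\<dots> = (\<integral>\<^sup>+y. \<integral>\<^sup>+x. f (T x) * indicator B (y - T x) \<partial>lborel \<partial>lborel)"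
    by (rule lborel_pair.Fubini'[symmetric]) measurable
  also have "\<dots> = (\<integral>\<^sup>+y. \<integral>\<^sup>+x. f (T x + y) * indicator B (- T x) \<partial>lborel \<partial>lborel)"
  proof (rule nn_integral_cong)
    fix y
    \<comment> \<open>Translating \<open>x\<close> by the preimage of \<open>y\<close> moves the
      dependence on \<open>y\<close> from the indicator of \<open>B\<close> to the argument of
      \<open>f\<close>.\<close>
    obtain z where "T z = y" using T(2) by (metis bij_pointE)
    then have y: "T (x + z) = T x + y" for x
      using T by (simp add: linear_add)
    have "(\<integral>\<^sup>+x. f (T x) * indicator B (y - T x) \<partial>lborel)
        = (\<integral>\<^sup>+x. f (T (x + z)) * indicator B (y - T (x + z)) \<partial>lborel)"
      by (rule nn_integral_lborel_translate[symmetric]) measurable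
    then show "(\<integral>\<^sup>+x. f (T x) * indicator B (y - T x) \<partial>lborel)
        = (\<integral>\<^sup>+x. f (T x + y) * indicator B (- T x) \<partial>lborel)"
      by (simp add: y)
  qed
  also have "\<dots> = (\<integral>\<^sup>+x. \<integral>\<^sup>+y. f (T x + y) * indicator B (- T x) \<partial>lborel \<partial>lborel)"
    by (rule lborel_pair.Fubini') measurable
  also have "\<dots> = (\<integral>\<^sup>+x. indicator {x. - T x \<in> B} x * (\<integral>\<^sup>+y. f y \<partial>lborel) \<partial>lborel)"
  proof (rule nn_integral_cong)
    fix x
    have "(\<integral>\<^sup>+y. f (T x + y) * indicator B (- T x) \<partial>lborel) = (\<integral>\<^sup>+y. f (y + T x) \<partial>lborel) * indicator B (- T x)"
      by (simp add: nn_integral_multc add.commute)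
    then show "(\<integral>\<^sup>+y. f (T x + y) * indicator B (- T x) \<partial>lborel)
        = indicator {x. - T x \<in> B} x * (\<integral>\<^sup>+y. f y \<partial>lborel)"
      by (simp add: nn_integral_lborel_translate indicator_def mult.commute)
  qed
  also have "\<dots> = emeasure lborel {x. - T x \<in> B} * (\<integral>\<^sup>+x. f x \<partial>lborel)"
    by (subst nn_integral_multc) simp_all
  finally show ?thesis .
qed

section \<open>Lebesgue measure on \<open>R_perp\<close>\<close>

lemma linear_borel_measurable:
  fixes T :: "'a::euclidean_space \<Rightarrow> 'b::euclidean_space"
  assumes "linear T"
  shows "T \<in> borel_measurable borel"
  using assms by (intro borel_measurable_continuous_onI linear_continuous_on) (simp add: linear_conv_bounded_linear)

lemmas [measurable] = linear_borel_measurable[OF linear_mean] linear_borel_measurable[OF linear_perp]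

lemma sq_len_eq_norm: "sq_len v = (norm v)\<^sup>2"
  unfolding sq_len_def power2_norm_eq_inner inner_vec_def by (simp add: power2_eq_square)

lemma sq_len_nonneg [simp]: "0 \<le> sq_len v"
  by (simp add: sq_len_eq_norm)

lemma borel_measurable_sq_len [measurable]: "sq_len \<in> borel_measurable borel"
  unfolding sq_len_eq_norm[abs_def] by measurable

lemma inner_Phi: "v \<bullet> Phi = real CARD('p) * mean (v :: 'p::nontriv R)"
  by (simp add: inner_vec_def Phi_def mean_def)

lemma sq_len_add_Phi:
  fixes v :: "'p::nontriv R"
  assumes "mean v = 0"
  shows "sq_len (v + a *\<^sub>R Phi) = sq_len v + real CARD('p) * a\<^sup>2"
proof -
  have "sq_len (v + a *\<^sub>R Phi) = sq_len v + 2 * a * (v \<bullet> Phi) + a\<^sup>2 * (Phi \<bullet> (Phi :: 'p R))"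
    unfolding sq_len_eq_norm power2_norm_eq_inner
    by (simp add: inner_add_left inner_add_right inner_commute[of Phi v] power2_eq_square distrib_left)
  then show ?thesis by (simp add: inner_Phi assms)
qed

lemma sq_len_decomp: "sq_len (v :: 'p::nontriv R) = sq_len (perp v) + real CARD('p) * (mean v)\<^sup>2"
  using sq_len_add_Phi[OF mean_perp, of v "mean v"] by (simp add: perp_def)

text \<open>The integral over \<open>R_perp\<close>, up to the constant factor \<open>sqrt N\<close> relative to \<open>lebesgue_perp\<close>.\<close>

definition slab_integral :: "('p::nontriv R \<Rightarrow> ennreal) \<Rightarrow> ennreal" where
  "slab_integral G = (\<integral>\<^sup>+v. indicator {0..<1} (mean v) * G (perp v) \<partial>lborel)"

text \<open>Fubini for the orthogonal splitting, without choosing coordinates on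
  \<open>R_perp\<close>: insert the factor 1 as the integral over \<open>a\<close> of the indicator
  that \<open>mean v - a\<close> lies in \<open>{0..<1}\<close>, exchange the integrals, and
  translate \<open>v\<close> by \<open>a\<close> times \<open>Phi\<close>.\<close>

lemma nn_integral_perp_mean:
  fixes G :: "'p::nontriv R \<Rightarrow> real \<Rightarrow> ennreal"
  assumes [measurable]: "case_prod G \<in> borel_measurable (borel \<Otimes>\<^sub>M borel)"
  shows "(\<integral>\<^sup>+v. G (perp v) (mean v) \<partial>lborel) = slab_integral (\<lambda>u. \<integral>\<^sup>+a. G u a \<partial>lborel)"
proof -
  have "(\<integral>\<^sup>+v. G (perp v) (mean v) \<partial>lborel)
      = (\<integral>\<^sup>+v. \<integral>\<^sup>+a. G (perp v) (mean v) * indicator {0..<1} (mean v - a) \<partial>lborel \<partial>lborel)"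
  proof (rule nn_integral_cong)
    fix v :: "'p R"
    have "(\<integral>\<^sup>+a. G (perp v) (mean v) * indicator {0..<1} (mean v - a) \<partial>lborel)
        = (\<integral>\<^sup>+a. G (perp v) (mean v) * indicator {mean v - 1<..mean v} a \<partial>lborel)"
      by (intro nn_integral_cong) (auto split: split_indicator)
    then show "G (perp v) (mean v) = (\<integral>\<^sup>+a. G (perp v) (mean v) * indicator {0..<1} (mean v - a) \<partial>lborel)"
      by (simp add: nn_integral_cmult)
  qed
  also have "\<dots> = (\<integral>\<^sup>+a. \<integral>\<^sup>+v. G (perp v) (mean v) * indicator {0..<1} (mean v - a) \<partial>lborel \<partial>lborel)"
    by (rule lborel_pair.Fubini'[symmetric]) measurable
  also have "\<dots> = (\<integral>\<^sup>+a. \<integral>\<^sup>+v. G (perp v) (mean v + a) * indicator {0..<1} (mean v) \<partial>lborel \<partial>lborel)"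
  proof (rule nn_integral_cong)
    fix a :: real
    have "(\<integral>\<^sup>+v. G (perp v) (mean v) * indicator {0..<1} (mean v - a) \<partial>lborel)
      = (\<integral>\<^sup>+v. G (perp (v + a *\<^sub>R Phi)) (mean (v + a *\<^sub>R Phi)) * indicator {0..<1} (mean (v + a *\<^sub>R Phi) - a) \<partial>lborel)"
      by (rule nn_integral_lborel_translate[symmetric]) measurable
    then show "(\<integral>\<^sup>+v. G (perp v) (mean v) * indicator {0..<1} (mean v - a) \<partial>lborel)
      = (\<integral>\<^sup>+v. G (perp v) (mean v + a) * indicator {0..<1} (mean v) \<partial>lborel)"
      by (simp add: linear_add[OF linear_perp] linear_add[OF linear_mean]
          linear_scale[OF linear_perp] linear_scale[OF linear_mean])
  qed
  also have "\<dots> = (\<integral>\<^sup>+v. \<integral>\<^sup>+a. G (perp v) (mean v + a) * indicator {0..<1} (mean v) \<partial>lborel \<partial>lborel)"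
    by (rule lborel_pair.Fubini') measurable
  also have "\<dots> = slab_integral (\<lambda>u. \<integral>\<^sup>+a. G u a \<partial>lborel)"
    unfolding slab_integral_def
  proof (rule nn_integral_cong)
    fix v :: "'p R"
    have "(\<integral>\<^sup>+a. G (perp v) (mean v + a) * indicator {0..<1} (mean v) \<partial>lborel)
      = (\<integral>\<^sup>+a. G (perp v) (a + mean v) \<partial>lborel) * indicator {0..<1} (mean v)"
      by (simp add: nn_integral_multc add.commute)
    also have "(\<integral>\<^sup>+a. G (perp v) (a + mean v) \<partial>lborel) = (\<integral>\<^sup>+a. G (perp v) a \<partial>lborel)"
      by (rule nn_integral_lborel_translate) measurable
    finally show "(\<integral>\<^sup>+a. G (perp v) (mean v + a) * indicator {0..<1} (mean v) \<partial>lborel)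
        = indicator {0..<1} (mean v) * (\<integral>\<^sup>+a. G (perp v) a \<partial>lborel)"
      by (simp add: mult.commute)
  qed
  finally show ?thesis .
qed

lemma slab_integral_cong:
  "(\<And>u. u \<in> R_perp \<Longrightarrow> F u = G u) \<Longrightarrow> slab_integral F = slab_integral G"
  unfolding slab_integral_def by (intro nn_integral_cong) simp

lemma slab_integral_mono:
  "(\<And>u. u \<in> R_perp \<Longrightarrow> F u \<le> G u) \<Longrightarrow> slab_integral F \<le> slab_integral G"
  unfolding slab_integral_def by (intro nn_integral_mono mult_left_mono) simp_all

lemma slab_integral_cmult:
  assumes [measurable]: "G \<in> borel_measurable borel"
  shows "slab_integral (\<lambda>u. c * G u) = c * slab_integral G"
  unfolding slab_integral_def by (subst nn_integral_cmult[symmetric]) (simp_all add: mult_ac)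

lemma slab_integral_add:
  assumes [measurable]: "F \<in> borel_measurable borel" "G \<in> borel_measurable borel"
  shows "slab_integral (\<lambda>u. F u + G u) = slab_integral F + slab_integral G"
  unfolding slab_integral_def by (subst nn_integral_add[symmetric]) (simp_all add: distrib_left)

lemma slab_integral_sum:
  assumes [measurable]: "\<And>j. j \<in> J \<Longrightarrow> F j \<in> borel_measurable borel"
  shows "slab_integral (\<lambda>u. \<Sum>j\<in>J. F j u) = (\<Sum>j\<in>J. slab_integral (F j))"
  unfolding slab_integral_def by (subst nn_integral_sum[symmetric]) (simp_all add: sum_distrib_left)

lemma slab_integral_translate:
  assumes [measurable]: "G \<in> borel_measurable borel" and "l \<in> R_perp"
  shows "slab_integral (\<lambda>u. G (u + l)) = slab_integral G"
proof -
  have "mean l = 0" "perp l = l" using assms(2) perp_ident by (auto simp: R_perp_iff)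
  then have "mean (v + l) = mean v" "perp (v + l) = perp v + l" for v
    by (simp_all add: linear_add[OF linear_mean] linear_add[OF linear_perp])
  then show ?thesis
    unfolding slab_integral_def
    using nn_integral_lborel_translate[of "\<lambda>v. indicator {0..<1} (mean v) * G (perp v)" l] by simp
qed

lemma emeasure_ball_pos: "0 < r \<Longrightarrow> 0 < emeasure lborel (ball (a :: 'a::euclidean_space) r)"
  by (simp add: emeasure_ball ennreal_zero_less_mult_iff)

text \<open>The constant is the ratio of the volumes of the unit ball and of its preimage under
  \<open>- T\<close>. Upper and lower bounds for \<open>T\<close> enclose the preimage between two
  balls, so the ratio is positive and finite; its value cancels later.\<close>

lemma slab_integral_linear:
  fixes T :: "'p::nontriv R \<Rightarrow> 'p R"
  assumes T: "linear T" "bij T" "\<And>v. mean (T v) = mean v" "\<And>v. perp (T v) = T (perp v)"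
  obtains c where "0 < c" "\<And>G. G \<in> borel_measurable borel \<Longrightarrow> slab_integral G = ennreal c * slab_integral (\<lambda>u. G (T u))"
proof -
  let ?B = "ball 0 1 :: 'p R set"
  let ?B' = "{x. - T x \<in> ?B}"
  have bl: "bounded_linear T" using T(1) by (simp add: linear_conv_bounded_linear)
  obtain e where e: "0 < e" "\<And>x. e * norm x \<le> norm (T x)"
    using linear_inj_bounded_below_pos[OF T(1)] bij_is_inj[OF T(2)] by auto
  obtain K where K: "0 < K" "\<And>x. norm (T x) \<le> norm x * K"
    using bounded_linear.pos_bounded[OF bl] by blast
  have [measurable]: "T \<in> borel_measurable borel" using T(1) by (rule linear_borel_measurable)
  have "?B' \<subseteq> ball 0 (1 / e)"
  proof
    fix x assume "x \<in> ?B'"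
    then have "e * norm x < 1" using e(2)[of x] by simp
    then show "x \<in> ball 0 (1 / e)" using e(1) by (simp add: field_simps)
  qed
  then have "emeasure lborel ?B' \<le> emeasure lborel (ball (0 :: 'p R) (1 / e))"
    by (intro emeasure_mono) auto
  also have "\<dots> < \<infinity>" by (rule emeasure_bounded_finite) simp
  finally have fin: "emeasure lborel ?B' < \<infinity>" .
  have "ball 0 (1 / K) \<subseteq> ?B'"
  proof
    fix x :: "'p R" assume "x \<in> ball 0 (1 / K)"
    then have "norm x * K < 1" using K(1) by (simp add: field_simps)
    then show "x \<in> ?B'" using K(2)[of x] by simp
  qed
  then have "emeasure lborel (ball (0 :: 'p R) (1 / K)) \<le> emeasure lborel ?B'"
    by (intro emeasure_mono) simp_all
  moreover have "0 < emeasure lborel (ball (0 :: 'p R) (1 / K))" using K(1) by (intro emeasure_ball_pos) simp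
  ultimately have pos: "0 < emeasure lborel ?B'" by order
  obtain y where y: "emeasure lborel ?B' = ennreal y" "0 < y"
    using fin pos by (cases "emeasure lborel ?B'") auto
  have "emeasure lborel ?B < \<infinity>" by (rule emeasure_bounded_finite) simp
  moreover have "0 < emeasure lborel ?B" by (rule emeasure_ball_pos) simp
  ultimately obtain x where x: "emeasure lborel ?B = ennreal x" "0 < x"
    by (cases "emeasure lborel ?B") auto
  show ?thesis
  proof
    show "0 < x / y" using x y by simp
    fix G :: "'p R \<Rightarrow> ennreal" assume [measurable]: "G \<in> borel_measurable borel"
    have "ennreal x * slab_integral (\<lambda>u. G (T u)) = ennreal y * slab_integral G"
      unfolding slab_integral_def
      using nn_integral_linear_bij[OF T(1,2), of "\<lambda>v. indicator {0..<1} (mean v) * G (perp v)" ?B]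
      unfolding T x(1) y(1) by (simp add: T)
    then have "ennreal (1 / y) * (ennreal x * slab_integral (\<lambda>u. G (T u)))
        = ennreal (1 / y) * (ennreal y * slab_integral G)" by simp
    then show "slab_integral G = ennreal (x / y) * slab_integral (\<lambda>u. G (T u))"
      using x y by (simp add: mult.assoc[symmetric] ennreal_mult'[symmetric])
  qed
qed

lemma slab_integral_isometry:
  fixes T :: "'p::nontriv R \<Rightarrow> 'p R"
  assumes T: "linear T" "bij T" "\<And>v. mean (T v) = mean v" "\<And>v. perp (T v) = T (perp v)"
    and iso: "\<And>v. norm (T v) = norm v" and [measurable]: "G \<in> borel_measurable borel"
  shows "slab_integral (\<lambda>u. G (T u)) = slab_integral G"
proof -
  let ?B = "ball 0 1 :: 'p R set"
  \<comment> \<open>An isometry preserves the test ball, so the constant of the general linear case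
    is 1.\<close>
  have "{x. - T x \<in> ?B} = ?B" by (simp add: iso ball_def dist_norm)
  then have "emeasure lborel ?B * slab_integral (\<lambda>u. G (T u)) = emeasure lborel ?B * slab_integral G"
    unfolding slab_integral_def
    using nn_integral_linear_bij[OF T(1,2), of "\<lambda>v. indicator {0..<1} (mean v) * G (perp v)" ?B]
    by (simp add: T)
  moreover have "emeasure lborel ?B < \<infinity>" by (rule emeasure_bounded_finite) simp
  moreover have "0 < emeasure lborel ?B" by (rule emeasure_ball_pos) simp
  ultimately show ?thesis by (auto simp: ennreal_mult_cancel_left)
qed

section \<open>The measure on the hyperplane expressed by slab integrals\<close>

definition perp_measure :: "'p::nontriv R measure" where
  "perp_measure = distr (restrict_space lborel {v. inner v Phi / sqrt (real CARD('p)) \<in> {0..1}})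
     (restrict_space borel R_perp) (\<lambda>v. v - pi0 v)"

lemma lebesgue_perp_eq: "lebesgue_perp = completion perp_measure"
  by (simp add: lebesgue_perp_def perp_measure_def)

lemma R_perp_borel [measurable]: "R_perp \<in> sets borel"
proof -
  have "R_perp = {v :: 'a R. mean v = 0}" by (auto simp: R_perp_iff)
  moreover have "{v :: 'a R. mean v = 0} \<in> sets borel" by measurable
  ultimately show ?thesis by simp
qed

lemma space_perp_measure [simp]: "space perp_measure = R_perp"
  by (simp add: perp_measure_def space_restrict_space)

lemma sets_perp_measure [measurable_cong]: "sets perp_measure = sets (restrict_space borel R_perp)"
  by (simp add: perp_measure_def)

lemma sets_perp_measure_iff: "A \<in> sets perp_measure \<longleftrightarrow> A \<in> sets borel \<and> A \<subseteq> R_perp"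
  unfolding sets_perp_measure by (subst sets_restrict_space_iff) auto

lemma borel_measurable_perp_measure:
  "f \<in> borel_measurable borel \<Longrightarrow> f \<in> borel_measurable perp_measure"
  using measurable_restrict_space1 measurable_cong_sets[OF sets_perp_measure refl] by blast

text \<open>The coordinate along the unit normal is \<open>sqrt N\<close> times the mean. A cylinder
  of height 1 therefore has means in an interval of length \<open>1 / sqrt N\<close>, against length
  1 in \<open>slab_integral\<close>.\<close>

lemma nn_integral_perp_measure:
  fixes G :: "'p::nontriv R \<Rightarrow> ennreal"
  assumes [measurable]: "G \<in> borel_measurable borel"
  shows "(\<integral>\<^sup>+u. G u \<partial>perp_measure) = ennreal (1 / sqrt (real CARD('p))) * slab_integral G"
proof -
  let ?N = "real CARD('p)"
  let ?S = "{v :: 'p R. v \<bullet> Phi / sqrt ?N \<in> {0..1}}"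
  have S: "v \<in> ?S \<longleftrightarrow> mean v \<in> {0..1 / sqrt ?N}" for v
  proof -
    have "v \<bullet> Phi / sqrt ?N = sqrt ?N * mean v"
      unfolding inner_Phi by (metis card_nontriv_pos of_nat_0_le_iff real_div_sqrt times_divide_eq_left mult.commute)
    moreover have "sqrt ?N * mean v \<in> {0..1} \<longleftrightarrow> mean v \<in> {0..1 / sqrt ?N}"
      by (simp add: pos_le_divide_eq zero_le_mult_iff mult.commute)
    ultimately show ?thesis by (simp only: mem_Collect_eq)
  qed
  have [measurable]: "?S \<in> sets borel" unfolding S[THEN Collect_cong] by measurable
  have m: "(\<lambda>v. v - pi0 v) \<in> measurable (restrict_space lborel ?S) (restrict_space borel (R_perp :: 'p R set))"
    unfolding perp_eq[symmetric]
    by (intro measurable_restrict_space2 measurable_restrict_space1) simp_all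
  have "(\<integral>\<^sup>+u. G u \<partial>perp_measure) = (\<integral>\<^sup>+v. G (v - pi0 v) \<partial>restrict_space lborel ?S)"
    unfolding perp_measure_def by (rule nn_integral_distr[OF m]) (simp add: measurable_restrict_space1)
  also have "\<dots> = (\<integral>\<^sup>+v. G (perp v) * indicator {0..1 / sqrt ?N} (mean v) \<partial>lborel)"
    by (subst nn_integral_restrict_space)
       (auto simp: perp_eq S[simplified] intro!: nn_integral_cong split: split_indicator)
  also have "\<dots> = slab_integral (\<lambda>u. \<integral>\<^sup>+a. G u * indicator {0..1 / sqrt ?N} a \<partial>lborel)"
    by (rule nn_integral_perp_mean) measurable
  also have "\<dots> = slab_integral (\<lambda>u. ennreal (1 / sqrt ?N) * G u)"
    by (intro slab_integral_cong) (simp add: nn_integral_cmult mult.commute)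
  also have "\<dots> = ennreal (1 / sqrt ?N) * slab_integral G" by (rule slab_integral_cmult) measurable
  finally show ?thesis .
qed

lemma emeasure_perp_measure:
  fixes A :: "'p::nontriv R set"
  assumes "A \<in> sets borel" "A \<subseteq> R_perp"
  shows "emeasure perp_measure A = ennreal (1 / sqrt (real CARD('p))) * slab_integral (indicator A)"
  using nn_integral_perp_measure[of "indicator A"] assms by (simp add: sets_perp_measure_iff)

lemma perp_measure_translate:
  fixes l :: "'p::nontriv R"
  assumes l: "l \<in> R_perp"
  shows "(\<lambda>x. x + l) \<in> measurable perp_measure perp_measure"
    and "distr perp_measure perp_measure (\<lambda>x. x + l) = perp_measure"
proof -
  have R: "x \<in> R_perp \<Longrightarrow> x + l \<in> R_perp" for x
    using l by (simp add: R_perp_iff linear_add[OF linear_mean])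
  have "(\<lambda>x. x + l) \<in> measurable (restrict_space borel R_perp) (restrict_space borel R_perp)"
    using R by (intro measurable_restrict_space2 measurable_restrict_space1) (auto simp: space_restrict_space)
  then show m: "(\<lambda>x. x + l) \<in> measurable perp_measure perp_measure"
    using measurable_cong_sets[OF sets_perp_measure sets_perp_measure] by blast
  show "distr perp_measure perp_measure (\<lambda>x. x + l) = perp_measure"
  proof (rule measure_eqI)
    fix A :: "'p R set" assume "A \<in> sets (distr perp_measure perp_measure (\<lambda>x. x + l))"
    then have As: "A \<in> sets perp_measure" by simp
    then have A [measurable]: "A \<in> sets borel" and "A \<subseteq> R_perp" by (simp_all add: sets_perp_measure_iff)
    have "emeasure (distr perp_measure perp_measure (\<lambda>x. x + l)) A
        = (\<integral>\<^sup>+x. indicator A (x + l) \<partial>perp_measure)"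
      using m As by (subst nn_integral_indicator[symmetric], simp, subst nn_integral_distr) simp_all
    also have "\<dots> = (\<integral>\<^sup>+x. indicator A x \<partial>perp_measure)"
      using slab_integral_translate[of "indicator A", OF _ l] by (simp add: nn_integral_perp_measure)
    finally show "emeasure (distr perp_measure perp_measure (\<lambda>x. x + l)) A = emeasure perp_measure A"
      using As by simp
  qed simp
qed

lemma AE_perp_measure:
  fixes A :: "'p::nontriv R set"
  assumes [measurable]: "A \<in> sets borel" and "AE v in lborel. perp v \<notin> A"
  shows "AE u in perp_measure. u \<notin> A"
proof -
  have "slab_integral (indicator A) = (\<integral>\<^sup>+v. 0 \<partial>(lborel :: 'p R measure))"
    unfolding slab_integral_def using assms(2) by (intro nn_integral_cong_AE) auto
  then have "emeasure perp_measure (A \<inter> R_perp) = 0"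
    using slab_integral_cong[of "indicator (A \<inter> R_perp)" "indicator A"]
    by (subst emeasure_perp_measure) (simp_all add: indicator_def)
  then show ?thesis
    by (intro AE_I[of _ _ "A \<inter> R_perp"]) (auto simp: sets_perp_measure_iff)
qed

lemma AE_lborel_linear_bij:
  fixes T :: "'a::euclidean_space \<Rightarrow> 'a"
  assumes T: "linear T" "bij T" and [measurable]: "A \<in> sets borel" and A: "AE x in lborel. x \<notin> A"
  shows "AE x in lborel. T x \<notin> A"
proof -
  have [measurable]: "T \<in> borel_measurable borel" using T(1) by (rule linear_borel_measurable)
  have "(\<integral>\<^sup>+x. indicator A x \<partial>lborel) = (\<integral>\<^sup>+x. 0 \<partial>(lborel :: 'a measure))"
    using A by (intro nn_integral_cong_AE) auto
  then have "emeasure lborel (ball (0 :: 'a) 1) * (\<integral>\<^sup>+x. indicator A (T x) \<partial>lborel) = 0"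
    using nn_integral_linear_bij[OF T, of "indicator A" "ball 0 1"] by simp
  moreover have "0 < emeasure lborel (ball (0 :: 'a) 1)" by (rule emeasure_ball_pos) simp
  ultimately have "(\<integral>\<^sup>+x. indicator A (T x) \<partial>lborel) = 0" by auto
  then have "AE x in lborel. indicator A (T x) = (0 :: ennreal)"
    by (subst (asm) nn_integral_0_iff_AE) measurable
  then show ?thesis by eventually_elim (auto split: split_indicator_asm)
qed

section \<open>The Voronoi cell\<close>

lemma countable_Z_lat: "countable (Z_lat :: 'p::nontriv R set)"
proof -
  have "(Z_lat :: 'p R set) \<subseteq> (\<lambda>f. \<chi> i. of_int (f i)) ` PiE (UNIV :: 'p mod_ring set) (\<lambda>_. UNIV :: int set)"
  proof
    fix v :: "'p R" assume "v \<in> Z_lat"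
    then have "v $ i = of_int \<lfloor>v $ i\<rfloor>" for i by (simp add: Z_lat_def)
    then have "v = (\<chi> i. of_int ((\<lambda>i. \<lfloor>v $ i\<rfloor>) i))" by (simp add: vec_eq_iff)
    then show "v \<in> (\<lambda>f. \<chi> i. of_int (f i)) ` PiE UNIV (\<lambda>_. UNIV :: int set)" by (metis PiE_UNIV_domain UNIV_I image_eqI Pi_UNIV)
  qed
  moreover have "countable (PiE (UNIV :: 'p mod_ring set) (\<lambda>_. UNIV :: int set))"
    by (intro countable_PiE) auto
  ultimately show ?thesis by (meson countable_image countable_subset)
qed

definition perp_lat :: "'p::nontriv R set" where
  "perp_lat = perp ` Z_lat"

lemma countable_perp_lat: "countable perp_lat"
  unfolding perp_lat_def by (intro countable_image countable_Z_lat)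

lemma perp_lat_R_perp: "p \<in> perp_lat \<Longrightarrow> p \<in> R_perp"
  by (auto simp: perp_lat_def)

lemma perp_lat_diff: "p \<in> perp_lat \<Longrightarrow> q \<in> perp_lat \<Longrightarrow> p - q \<in> perp_lat"
  unfolding perp_lat_def by (auto simp: linear_diff[OF linear_perp, symmetric] Z_lat_diff)

lemma zero_perp_lat: "0 \<in> perp_lat"
  unfolding perp_lat_def by (rule image_eqI[of _ _ 0]) (auto simp: linear_0[OF linear_perp] Z_lat_def)

lemma perp_lat_uminus: "p \<in> perp_lat \<Longrightarrow> - p \<in> perp_lat"
  using perp_lat_diff[OF zero_perp_lat] by simp

lemma perp_lat_add: "p \<in> perp_lat \<Longrightarrow> q \<in> perp_lat \<Longrightarrow> p + q \<in> perp_lat"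
  using perp_lat_diff[of p "- q"] perp_lat_uminus[of q] by simp

lemma R_perp_diff: "u \<in> R_perp \<Longrightarrow> v \<in> R_perp \<Longrightarrow> u - v \<in> R_perp"
  by (simp add: R_perp_iff linear_diff[OF linear_mean])

text \<open>The inequality is strict so that 0 is the only nearest lattice point; on translates of
  this set every admissible quantizer takes the same value.\<close>

definition voronoi :: "'p::nontriv R set" where
  "voronoi = {u \<in> R_perp. \<forall>p\<in>perp_lat. p \<noteq> 0 \<longrightarrow> sq_len u < sq_len (u - p)}"

text \<open>Equidistance from any two lattice points counts, whether or not they are nearest. The
  set is still a countable union of hyperplanes.\<close>

definition ties :: "'p::nontriv R set" where
  "ties = (\<Union>p\<in>perp_lat. \<Union>q\<in>perp_lat - {p}. {u. sq_len (u - p) = sq_len (u - q)})"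

lemma voronoi_borel [measurable]: "voronoi \<in> sets borel"
proof -
  have "voronoi = R_perp - (\<Union>p\<in>perp_lat - {0}. {u :: 'a R. \<not> sq_len u < sq_len (u - p)})"
    unfolding voronoi_def by auto
  also have "\<dots> \<in> sets borel"
    using countable_perp_lat by (intro sets.Diff sets.countable_UN'' R_perp_borel) (auto intro: countable_Diff)
  finally show ?thesis .
qed

lemma ties_borel [measurable]: "ties \<in> sets borel"
  unfolding ties_def
  using countable_perp_lat by (intro sets.countable_UN'') (auto intro: countable_Diff)

lemma voronoi_R_perp: "u \<in> voronoi \<Longrightarrow> u \<in> R_perp"
  by (simp add: voronoi_def)

lemma voronoi_shift:
  assumes "u \<in> R_perp" "p \<in> perp_lat"
  shows "u - p \<in> voronoi \<longleftrightarrow> (\<forall>q\<in>perp_lat. q \<noteq> p \<longrightarrow> sq_len (u - p) < sq_len (u - q))"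
proof
  assume v: "u - p \<in> voronoi"
  show "\<forall>q\<in>perp_lat. q \<noteq> p \<longrightarrow> sq_len (u - p) < sq_len (u - q)"
  proof (intro ballI impI)
    fix q assume q: "q \<in> perp_lat" "q \<noteq> p"
    then have "q - p \<in> perp_lat" "q - p \<noteq> 0" using assms perp_lat_diff by auto
    then have "sq_len (u - p) < sq_len (u - p - (q - p))" using v unfolding voronoi_def by blast
    then show "sq_len (u - p) < sq_len (u - q)" by simp
  qed
next
  assume *: "\<forall>q\<in>perp_lat. q \<noteq> p \<longrightarrow> sq_len (u - p) < sq_len (u - q)"
  have "sq_len (u - p) < sq_len (u - p - q)" if "q \<in> perp_lat" "q \<noteq> 0" for q
    using *[rule_format, OF perp_lat_add[OF assms(2) that(1)]] that(2) by (simp add: diff_diff_eq)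
  then show "u - p \<in> voronoi"
    using assms by (simp add: voronoi_def R_perp_diff perp_lat_R_perp)
qed

lemma inner_perp: "r \<in> R_perp \<Longrightarrow> perp v \<bullet> r = v \<bullet> r"
  by (simp add: perp_def inner_diff_left inner_commute[of Phi] inner_Phi R_perp_iff)

text \<open>The difference of two squared distances is affine in the point, with normal
  \<open>q - p\<close>. As this normal lies in \<open>R_perp\<close>, the projection drops out and
  the condition is a hyperplane in \<open>v\<close> itself.\<close>

lemma AE_perp_notin_ties: "AE v in lborel. perp v \<notin> (ties :: 'p::nontriv R set)"
proof -
  have "AE v in lborel. sq_len (perp v - p) \<noteq> sq_len (perp v - q)"
    if "p \<in> perp_lat" "q \<in> perp_lat" "p \<noteq> q" for p q :: "'p R"
  proof -
    have r: "q - p \<in> R_perp" using that by (simp add: R_perp_diff perp_lat_R_perp)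
    have eq: "sq_len (perp v - p) = sq_len (perp v - q) \<longleftrightarrow> (q - p) \<bullet> v = (q \<bullet> q - p \<bullet> p) / 2" for v
    proof -
      have "sq_len (perp v - p) - sq_len (perp v - q) = 2 * (perp v \<bullet> (q - p)) - (q \<bullet> q - p \<bullet> p)"
        unfolding sq_len_eq_norm power2_norm_eq_inner
        by (simp add: inner_diff_left inner_diff_right inner_commute)
      then show ?thesis by (simp add: inner_perp[OF r] inner_commute[of v] field_simps) (smt (verit))
    qed
    have "negligible {v. (q - p) \<bullet> v = (q \<bullet> q - p \<bullet> p) / 2}"
      using that by (intro negligible_hyperplane) simp
    then have "{v. (q - p) \<bullet> v = (q \<bullet> q - p \<bullet> p) / 2} \<in> null_sets lebesgue"
      by (simp add: negligible_iff_null_sets)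
    then have "AE v in lebesgue. v \<notin> {v. (q - p) \<bullet> v = (q \<bullet> q - p \<bullet> p) / 2}"
      by (rule AE_not_in)
    then show ?thesis unfolding AE_completion_iff by (simp add: eq)
  qed
  then have "AE v in lborel. \<forall>p\<in>perp_lat. \<forall>q\<in>perp_lat - {p}. sq_len (perp v - p) \<noteq> sq_len (perp v - q :: 'p R)"
    unfolding AE_ball_countable[OF countable_perp_lat] AE_ball_countable[OF countable_Diff[OF countable_perp_lat]]
    by blast
  then show ?thesis by eventually_elim (auto simp: ties_def)
qed

text \<open>Compare with the lattice point obtained by rounding all coordinates: each of the N
  errors is at most 1/2, and projection only shortens. The bound serves finiteness of volume and of
  second moments.\<close>

lemma voronoi_bound:
  fixes u :: "'p::nontriv R"
  assumes "u \<in> voronoi"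
  shows "sq_len u \<le> real CARD('p) / 4"
proof -
  define z :: "'p R" where "z = (\<chi> i. of_int (round (u $ i)))"
  have z: "perp z \<in> perp_lat" unfolding perp_lat_def by (auto simp: z_def Z_lat_def)
  have "sq_len u \<le> sq_len (u - perp z)"
    using assms z by (cases "perp z = 0") (auto simp: voronoi_def intro: less_imp_le)
  also have "u - perp z = perp (u - z)"
    using voronoi_R_perp[OF assms] by (simp add: linear_diff[OF linear_perp] perp_ident)
  also have "sq_len (perp (u - z)) \<le> sq_len (u - z)" using sq_len_decomp[of "u - z"] by simp
  also have "\<dots> \<le> (\<Sum>i\<in>(UNIV :: 'p mod_ring set). 1 / 4)"
    unfolding sq_len_def
  proof (rule sum_mono)
    fix i
    have "\<bar>(u - z) $ i\<bar> \<le> 1 / 2" using of_int_round_abs_le[of "u $ i"] by (simp add: z_def abs_minus_commute)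
    then have "\<bar>(u - z) $ i\<bar>\<^sup>2 \<le> (1 / 2)\<^sup>2" by (intro power_mono) auto
    then show "((u - z) $ i)\<^sup>2 \<le> 1 / 4" by (simp add: power2_eq_square)
  qed
  finally show ?thesis by simp
qed

lemma iota_cyc_int_eq_perp_lat:
  "prime CARD('p) \<Longrightarrow> odd CARD('p) \<Longrightarrow> iota ` cyc_int CARD('p) = (perp_lat :: 'p::nontriv R set)"
  unfolding perp_lat_def by (rule iota_cyc_int)

lemma slab_integral_voronoi_finite: "slab_integral (indicator (voronoi :: 'p::nontriv R set)) < \<infinity>"
proof -
  let ?N = "real CARD('p)"
  have "slab_integral (indicator (voronoi :: 'p R set)) \<le> (\<integral>\<^sup>+v. indicator (cball (0 :: 'p R) (sqrt (2 * ?N))) v \<partial>lborel)"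
    unfolding slab_integral_def
  proof (rule nn_integral_mono)
    fix v :: "'p R"
    have "v \<in> cball 0 (sqrt (2 * ?N))" if "mean v \<in> {0..<1}" "perp v \<in> voronoi"
    proof -
      have "(mean v)\<^sup>2 \<le> 1" using that(1) by (simp add: power_le_one)
      then have "?N * (mean v)\<^sup>2 \<le> ?N * 1" by (intro mult_left_mono) auto
      moreover have "sq_len (perp v) \<le> ?N / 4" using that(2) by (rule voronoi_bound)
      ultimately have "sq_len v \<le> 2 * ?N" unfolding sq_len_decomp[of v] by linarith
      then have "(norm v)\<^sup>2 \<le> 2 * ?N" by (simp add: sq_len_eq_norm)
      then show ?thesis by (simp add: real_le_rsqrt)
    qed
    then show "indicator {0..<1} (mean v) * indicator voronoi (perp v)
        \<le> (indicator (cball 0 (sqrt (2 * ?N))) v :: ennreal)"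
      by (auto split: split_indicator)
  qed
  also have "\<dots> = emeasure lborel (cball (0 :: 'p R) (sqrt (2 * ?N)))" by simp
  also have "\<dots> < \<infinity>" by (rule emeasure_bounded_finite) simp
  finally show ?thesis .
qed

section \<open>The tiling by Voronoi cells\<close>

context
  fixes Q :: "'p::nontriv R \<Rightarrow> complex"
  assumes prime_card: "prime CARD('p)" and odd_card: "odd CARD('p)" and Q: "nearest_quantizer Q"
begin

lemma nearest_quantizer_perp_lat:
  assumes "u \<in> R_perp"
  shows "(iota (Q u) :: 'p R) \<in> perp_lat" "\<And>p. p \<in> perp_lat \<Longrightarrow> sq_len (u - iota (Q u)) \<le> sq_len (u - p)"
  using Q assms unfolding nearest_quantizer_def iota_cyc_int_eq_perp_lat[OF prime_card odd_card, symmetric] by auto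

lemma nearest_quantizer_eq:
  assumes "u \<in> R_perp" "p \<in> perp_lat" "u - p \<in> voronoi"
  shows "iota (Q u) = p"
proof (rule ccontr)
  assume "iota (Q u) \<noteq> p"
  then have "sq_len (u - p) < sq_len (u - iota (Q u))"
    using assms(3) nearest_quantizer_perp_lat(1)[OF assms(1)] unfolding voronoi_shift[OF assms(1,2)] by simp
  with nearest_quantizer_perp_lat(2)[OF assms(1,2)] show False by simp
qed

text \<open>The existence of a nearest lattice point is read off from \<open>Q\<close>; away from
  ties its minimality is strict.\<close>

lemma ex1_voronoi:
  fixes u :: "'p R"
  assumes "u \<in> R_perp" "u \<notin> ties"
  shows "\<exists>!p. p \<in> perp_lat \<and> u - p \<in> voronoi"
proof (rule ex1I[of _ "iota (Q u)"])
  have "sq_len (u - iota (Q u)) < sq_len (u - q)" if "q \<in> perp_lat" "q \<noteq> iota (Q u)" for q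
  proof -
    have "sq_len (u - iota (Q u)) \<noteq> sq_len (u - q)"
      using nearest_quantizer_perp_lat(1)[OF assms(1)] that assms(2) unfolding ties_def by blast
    with nearest_quantizer_perp_lat(2)[OF assms(1) that(1)] show ?thesis by simp
  qed
  then show "(iota (Q u) :: 'p R) \<in> perp_lat \<and> u - iota (Q u) \<in> voronoi"
    using nearest_quantizer_perp_lat(1)[OF assms(1)]
      voronoi_shift[OF assms(1) nearest_quantizer_perp_lat(1)[OF assms(1)]] by simp
next
  fix p :: "'p R" assume "p \<in> perp_lat \<and> u - p \<in> voronoi"
  then show "p = iota (Q u)" using nearest_quantizer_eq[OF assms(1), of p] by simp
qed

lemma fundamental_domain_voronoi: "fundamental_domain perp_measure (perp_lat :: 'p R set) voronoi"
proof -
  have "AE u in perp_measure. u \<notin> (ties :: 'p R set)"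
    by (rule AE_perp_measure[OF ties_borel AE_perp_notin_ties])
  then have "AE u in perp_measure. \<exists>!p. p \<in> perp_lat \<and> u - p \<in> (voronoi :: 'p R set)"
    using AE_space by eventually_elim (simp add: ex1_voronoi)
  then show ?thesis
    unfolding fundamental_domain_def sets_perp_measure_iff using voronoi_R_perp by auto
qed

text \<open>If the cell were null, its countably many translates would be null as well. They cover
  almost all of the points with mean between 0 and 1, a set with nonempty interior.\<close>

lemma slab_integral_voronoi_pos: "0 < slab_integral (indicator (voronoi :: 'p R set))"
proof (rule ccontr)
  assume "\<not> 0 < slab_integral (indicator (voronoi :: 'p R set))"
  then have 0: "slab_integral (indicator (voronoi :: 'p R set)) = 0" by simp
  have "AE v in lborel. mean v \<in> {0..<1} \<longrightarrow> (\<forall>p\<in>perp_lat. perp v - p \<notin> (voronoi :: 'p R set))"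
  proof -
    have "AE v in lborel. mean v \<in> {0..<1} \<longrightarrow> perp v - p \<notin> voronoi" if p: "p \<in> perp_lat" for p :: "'p R"
    proof -
      have "slab_integral (\<lambda>u. indicator voronoi (u + - p)) = 0"
        using slab_integral_translate[of "indicator voronoi" "- p"] perp_lat_R_perp[OF perp_lat_uminus[OF p]] 0 by simp
      then have "AE v in lborel. indicator {0..<1} (mean v) * indicator voronoi (perp v + - p) = (0 :: ennreal)"
        unfolding slab_integral_def by (subst (asm) nn_integral_0_iff_AE) measurable
      then show ?thesis by eventually_elim (auto split: split_indicator_asm)
    qed
    then have "AE v in lborel. \<forall>p\<in>perp_lat. mean v \<in> {0..<1} \<longrightarrow> perp v - p \<notin> (voronoi :: 'p R set)"
      using countable_perp_lat by (subst AE_ball_countable) auto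
    then show ?thesis by eventually_elim auto
  qed
  with AE_perp_notin_ties have "AE v in (lborel :: 'p R measure). v \<notin> {v. 0 < mean v \<and> mean v < 1}"
  proof eventually_elim
    case (elim v)
    then show ?case using ex1_voronoi[of "perp v"] by fastforce
  qed
  moreover have "{v :: 'p R. 0 < mean v \<and> mean v < 1} \<in> sets lborel" by measurable
  ultimately have "{v :: 'p R. 0 < mean v \<and> mean v < 1} \<in> null_sets lborel"
    by (subst AE_iff_null_sets) auto
  then have "negligible {v :: 'p R. 0 < mean v \<and> mean v < 1}"
    unfolding negligible_iff_null_sets by (rule null_sets_completionI)
  moreover have "open {v :: 'p R. 0 < mean v \<and> mean v < 1}"
    using linear_continuous_on[of mean UNIV] linear_mean
    by (intro open_Collect_conj open_Collect_less continuous_on_const)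
       (simp_all add: linear_conv_bounded_linear)
  moreover have "(1 / 2) *\<^sub>R Phi \<in> {v :: 'p R. 0 < mean v \<and> mean v < 1}"
    by (simp add: linear_scale[OF linear_mean])
  ultimately show False using open_not_negligible by blast
qed

end

section \<open>Galois symmetry of the Voronoi cell\<close>

lemma linear_dilate: "linear (dilate a)"
  by (rule linearI) (simp_all add: dilate_def vec_eq_iff)

context
  fixes a b :: nat and ty :: "'p::nontriv itself"
  assumes ab: "(a * b) mod CARD('p) = 1"
begin

lemma mean_dilate: "mean (dilate a v) = mean (v :: 'p R)"
proof -
  have "fourier 0 (dilate a v) = fourier 0 v" using fourier_dilate[OF ab, of 0 v] by simp
  then show ?thesis unfolding fourier_0_mean by simp
qed

lemma perp_dilate: "perp (dilate a v) = dilate a (perp v :: 'p R)"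
  by (simp add: vec_eq_iff dilate_def mean_dilate[unfolded dilate_def])

lemma sq_len_dilate: "sq_len (dilate a v) = sq_len (v :: 'p R)"
proof -
  have "(of_nat a :: 'p mod_ring) * of_nat b = 1"
    using ab of_nat_mod_ring_eq_iff[of "a * b" 1, where 'p = 'p] unfolding one_mod_card by simp
  then have "of_nat a * (of_nat b * i) = i" "of_nat b * (of_nat a * i) = i" for i :: "'p mod_ring"
    by (metis mult.assoc mult.commute mult_1_left)+
  then show ?thesis
    unfolding sq_len_def
    by (intro sum.reindex_bij_witness[of _ "\<lambda>i. of_nat b * i" "\<lambda>i. of_nat a * i"]) (simp_all add: dilate_def)
qed

lemma dilate_perp_lat: "p \<in> perp_lat \<Longrightarrow> dilate a p \<in> (perp_lat :: 'p R set)"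
proof -
  assume "p \<in> perp_lat"
  then obtain z where z: "z \<in> Z_lat" "p = perp z" by (auto simp: perp_lat_def)
  then have "dilate a p = perp (dilate a z)" by (simp add: perp_dilate)
  with z show ?thesis unfolding perp_lat_def by (metis Z_lat_dilate imageI)
qed

end

lemma dilate_voronoi_iff:
  fixes u :: "'p::nontriv R"
  assumes ab: "(a * b) mod CARD('p) = 1"
  shows "dilate a u \<in> voronoi \<longleftrightarrow> u \<in> voronoi"
proof -
  have imp: "dilate a v \<in> voronoi" if ab: "(a * b) mod CARD('p) = 1" and v: "v \<in> voronoi" for a b and v :: "'p R"
  proof -
    have ba: "(b * a) mod CARD('p) = 1" using ab by (simp add: mult.commute)
    have "sq_len (dilate a v) < sq_len (dilate a v - p)" if p: "p \<in> perp_lat" "p \<noteq> 0" for p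
    proof -
      have "dilate b p \<noteq> 0"
        using dilate_dilate[OF ab, of p] p(2) linear_0[OF linear_dilate, of a] by metis
      then have "sq_len v < sq_len (v - dilate b p)"
        using v p dilate_perp_lat[OF ba] by (simp add: voronoi_def)
      also have "\<dots> = sq_len (dilate a (v - dilate b p))" by (simp add: sq_len_dilate[OF ab])
      also have "dilate a (v - dilate b p) = dilate a v - p"
        by (simp add: linear_diff[OF linear_dilate] dilate_dilate[OF ab])
      finally show ?thesis by (simp add: sq_len_dilate[OF ab])
    qed
    then show ?thesis using v by (simp add: voronoi_def R_perp_iff mean_dilate[OF ab])
  qed
  have ba: "(b * a) mod CARD('p) = 1" using ab by (simp add: mult.commute)
  show ?thesis using imp[OF ab, of u] imp[OF ba, of "dilate a u"] dilate_dilate[OF ba, of u] by auto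
qed

lemma borel_measurable_fourier [measurable]: "fourier j \<in> borel_measurable borel"
  unfolding fourier_def[abs_def] by (intro borel_measurable_continuous_onI continuous_intros)

lemma slab_integral_voronoi_fourier:
  assumes "prime CARD('p)" "0 < j" "j < CARD('p)"
  shows "slab_integral (\<lambda>u :: 'p::nontriv R. indicator voronoi u * ennreal ((norm (fourier j u))\<^sup>2))
    = slab_integral (\<lambda>u :: 'p R. indicator voronoi u * ennreal ((norm (fourier 1 u))\<^sup>2))"
proof -
  \<comment> \<open>Dilation by the inverse of \<open>j\<close> carries component 1 to component
    \<open>j\<close>.\<close>
  obtain a where ja: "(j * a) mod CARD('p) = 1" using ex_inverse_mod assms by blast
  then have aj: "(a * j) mod CARD('p) = 1" by (simp add: mult.commute)
  have "bij (dilate a :: 'p R \<Rightarrow> 'p R)"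
    by (rule bij_betw_byWitness[of _ "dilate j"]) (auto simp: dilate_dilate[OF ja] dilate_dilate[OF aj])
  then have "slab_integral (\<lambda>u :: 'p R. indicator voronoi (dilate a u) * ennreal ((norm (fourier 1 (dilate a u)))\<^sup>2))
    = slab_integral (\<lambda>u :: 'p R. indicator voronoi u * ennreal ((norm (fourier 1 u))\<^sup>2))"
    by (intro slab_integral_isometry[of "dilate a"] linear_dilate mean_dilate[OF aj] perp_dilate[OF aj])
       (use sq_len_dilate[OF aj] in \<open>auto simp: sq_len_eq_norm\<close>)
  then show ?thesis
    by (simp add: fourier_dilate[OF aj] indicator_def dilate_voronoi_iff[OF aj] cong: if_cong)
qed

section \<open>Mean-squared errors\<close>

text \<open>The two halves of the interval round to 0 and to 1, and each contributes 1/24.\<close>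

lemma nn_integral_square_rounding_error:
  "(\<integral>\<^sup>+a. ennreal ((of_int (round a) - a)\<^sup>2) * indicator {0..<1} a \<partial>lborel) = ennreal (1 / 12)"
proof -
  have "(\<integral>\<^sup>+a. ennreal ((of_int (round a) - a)\<^sup>2) * indicator {0..<1} a \<partial>lborel)
      = (\<integral>\<^sup>+a. ennreal (a\<^sup>2) * indicator {0..1 / 2} a + ennreal ((1 - a)\<^sup>2) * indicator {1 / 2..1} a \<partial>lborel)"
  proof (rule nn_integral_cong_AE)
    \<comment> \<open>The closed intervals overlap at 1/2, and 1 is missing on the left-hand side;
      both points are null.\<close>
    have "AE a in lborel. a \<noteq> 1 / 2 \<and> a \<noteq> (1 :: real)"
      using AE_lborel_singleton[of "1 / 2 :: real"] AE_lborel_singleton[of "1 :: real"] by eventually_elim simp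
    then show "AE a in lborel. ennreal ((of_int (round a) - a)\<^sup>2) * indicator {0..<1} a
      = ennreal (a\<^sup>2) * indicator {0..1 / 2} a + ennreal ((1 - a)\<^sup>2) * indicator {1 / 2..1 :: real} a"
    proof eventually_elim
      case (elim a)
      have "round a = 0" if "0 \<le> a" "a < 1 / 2" using that by (simp add: round_def floor_eq_iff)
      moreover have "round a = 1" if "1 / 2 < a" "a < 1" using that by (simp add: round_def floor_eq_iff)
      ultimately show ?case using elim by (auto split: split_indicator)
    qed
  qed
  also have "\<dots> = (\<integral>\<^sup>+a. ennreal (a\<^sup>2) * indicator {0..1 / 2} a \<partial>lborel)
      + (\<integral>\<^sup>+a. ennreal ((1 - a)\<^sup>2) * indicator {1 / 2..1} a \<partial>lborel)"
    by (rule nn_integral_add) measurable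
  also have "(\<integral>\<^sup>+a. ennreal (a\<^sup>2) * indicator {0..1 / 2} a \<partial>lborel) = ennreal ((1 / 2) ^ 3 / 3 - 0 ^ 3 / 3)"
    by (rule nn_integral_FTC_Icc) (auto intro!: derivative_eq_intros)
  also have "(\<integral>\<^sup>+a. ennreal ((1 - a)\<^sup>2) * indicator {1 / 2..1} a \<partial>lborel)
      = ennreal (- ((1 - 1) ^ 3 / 3) - (- ((1 - 1 / 2) ^ 3 / 3)))"
    by (rule nn_integral_FTC_Icc) (auto intro!: derivative_eq_intros)
  finally show ?thesis by (simp add: power3_eq_cube flip: ennreal_plus)
qed

lemma parseval_perp:
  "real CARD('p) * sq_len (perp v) = (\<Sum>j=1..<CARD('p). (norm (fourier j (v :: 'p::nontriv R)))\<^sup>2)"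
proof -
  have "{..<CARD('p)} = insert 0 {1..<CARD('p)}" using card_nontriv_pos[where 'p = 'p] by auto
  then have "real CARD('p) * sq_len (perp v) = (\<Sum>j=1..<CARD('p). (norm (fourier j (perp v)))\<^sup>2)"
    unfolding parseval[symmetric] by (simp add: fourier_0_mean)
  also have "\<dots> = (\<Sum>j=1..<CARD('p). (norm (fourier j v))\<^sup>2)"
    by (intro sum.cong refl) (simp add: fourier_perp)
  finally show ?thesis .
qed

lemma slab_integral_voronoi_fourier_finite:
  "slab_integral (\<lambda>u :: 'p::nontriv R. indicator voronoi u * ennreal ((norm (fourier 1 u))\<^sup>2)) < \<infinity>"
proof -
  let ?N = "real CARD('p)"
  have "slab_integral (\<lambda>u :: 'p R. indicator voronoi u * ennreal ((norm (fourier 1 u))\<^sup>2))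
      \<le> slab_integral (\<lambda>u :: 'p R. ennreal (?N * (?N / 4)) * indicator voronoi u)"
  proof (rule slab_integral_mono)
    fix u :: "'p R"
    have "(norm (fourier 1 u))\<^sup>2 \<le> ?N * (?N / 4)" if "u \<in> voronoi"
    proof -
      have "(norm (fourier 1 u))\<^sup>2 \<le> (\<Sum>j<CARD('p). (norm (fourier j u))\<^sup>2)"
        by (rule member_le_sum) (simp_all add: nontriv)
      also have "\<dots> = ?N * sq_len u" by (rule parseval)
      also have "\<dots> \<le> ?N * (?N / 4)" using voronoi_bound[OF that] by (intro mult_left_mono) auto
      finally show ?thesis .
    qed
    then show "indicator voronoi u * ennreal ((norm (fourier 1 u))\<^sup>2) \<le> ennreal (?N * (?N / 4)) * indicator voronoi u"
      by (auto split: split_indicator intro!: ennreal_leI)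
  qed
  also have "\<dots> < \<infinity>"
    using slab_integral_voronoi_finite[where 'p = 'p]
    by (subst slab_integral_cmult) (auto simp: ennreal_mult_less_top)
  finally show ?thesis .
qed

text \<open>Any quadratic form that is diagonal in the Fourier components has a second moment
  proportional to its trace. It is applied to the squared length before and after multiplication by
  \<beta>, which relates both errors to the same \<open>x\<close>.\<close>

lemma slab_integral_voronoi_fourier_sum:
  assumes prime_card: "prime CARD('p)"
    and x: "slab_integral (\<lambda>u :: 'p::nontriv R. indicator voronoi u * ennreal ((norm (fourier 1 u))\<^sup>2)) = ennreal x" "0 \<le> x"
    and c: "\<And>j. 0 \<le> c j"
    and f: "\<And>u. u \<in> R_perp \<Longrightarrow> f u = (\<Sum>j=1..<CARD('p). c j * (norm (fourier j u))\<^sup>2)"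
  shows "slab_integral (\<lambda>u :: 'p R. indicator voronoi u * ennreal (f u)) = ennreal ((\<Sum>j=1..<CARD('p). c j) * x)"
proof -
  have "slab_integral (\<lambda>u :: 'p R. indicator voronoi u * ennreal (f u))
      = slab_integral (\<lambda>u :: 'p R. \<Sum>j=1..<CARD('p). ennreal (c j) * (indicator voronoi u * ennreal ((norm (fourier j u))\<^sup>2)))"
    by (intro slab_integral_cong)
       (simp add: f sum_distrib_left mult_ac ennreal_mult c flip: sum_ennreal)
  also have "\<dots> = (\<Sum>j=1..<CARD('p). slab_integral (\<lambda>u :: 'p R. ennreal (c j) * (indicator voronoi u * ennreal ((norm (fourier j u))\<^sup>2))))"
    by (rule slab_integral_sum) measurable
  also have "\<dots> = (\<Sum>j=1..<CARD('p). ennreal (c j * x))"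
  proof (rule sum.cong)
    fix j assume "j \<in> {1..<CARD('p)}"
    then have j: "0 < j" "j < CARD('p)" by auto
    have "slab_integral (\<lambda>u :: 'p R. ennreal (c j) * (indicator voronoi u * ennreal ((norm (fourier j u))\<^sup>2)))
        = ennreal (c j) * slab_integral (\<lambda>u :: 'p R. indicator voronoi u * ennreal ((norm (fourier j u))\<^sup>2))"
      by (rule slab_integral_cmult) measurable
    also have "\<dots> = ennreal (c j * x)"
      unfolding slab_integral_voronoi_fourier[OF prime_card j] x(1) using c x(2) by (simp add: ennreal_mult)
    finally show "slab_integral (\<lambda>u :: 'p R. ennreal (c j) * (indicator voronoi u * ennreal ((norm (fourier j u))\<^sup>2)))
        = ennreal (c j * x)" .
  qed simp
  also have "\<dots> = ennreal ((\<Sum>j=1..<CARD('p). c j) * x)"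
    using c x(2) by (simp add: sum_distrib_right)
  finally show ?thesis .
qed

context
  fixes Q :: "'p::nontriv R \<Rightarrow> complex"
  assumes prime_card: "prime CARD('p)" and odd_card: "odd CARD('p)" and Q: "nearest_quantizer Q"
begin

lemma Delta_O_eq:
  assumes F: "fundamental_domain lebesgue_perp (iota ` cyc_int CARD('p)) F"
    and w: "slab_integral (indicator (voronoi :: 'p R set)) = ennreal w" "0 < w"
    and r: "slab_integral (\<lambda>u :: 'p R. indicator voronoi u * ennreal (sq_len u)) = ennreal r" "0 \<le> r"
  shows "Delta_O Q F = r / w"
proof -
  \<comment> \<open>The normalisation of the hyperplane measure; it cancels between the error
    integral and the volume.\<close>
  let ?k = "1 / sqrt (real CARD('p))"
  have k: "0 < ?k" by simp
  have "Delta_O Q F = (?k * r) / (?k * w)"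
    unfolding Delta_O_def lebesgue_perp_eq
  proof (rule integral_uniform_measure_fundamental_domain)
    show "countable (perp_lat :: 'p R set)" by (rule countable_perp_lat)
    show "fundamental_domain (completion perp_measure) perp_lat F"
      using F unfolding lebesgue_perp_eq iota_cyc_int_eq_perp_lat[OF prime_card odd_card] .
    show "fundamental_domain perp_measure (perp_lat :: 'p R set) voronoi"
      by (rule fundamental_domain_voronoi[OF prime_card odd_card Q])
    show "emeasure perp_measure (voronoi :: 'p R set) = ennreal (?k * w)"
      unfolding ennreal_mult'[OF less_imp_le[OF k]] w(1)[symmetric]
      by (rule emeasure_perp_measure) (auto simp: voronoi_R_perp)
    show "(\<integral>\<^sup>+u\<in>voronoi. ennreal (sq_len (u :: 'p R)) \<partial>perp_measure) = ennreal (?k * r)"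
      unfolding ennreal_mult'[OF less_imp_le[OF k]] r(1)[symmetric] mult.commute[of "ennreal (sq_len _)"]
      by (rule nn_integral_perp_measure) measurable
    show "sq_len (x - iota (Q x)) = sq_len (x - l)"
      if "x \<in> space perp_measure" "l \<in> perp_lat" "x - l \<in> voronoi" for x l
      using nearest_quantizer_eq[OF prime_card odd_card Q] that by simp
  qed (use k w r in \<open>auto simp: perp_lat_uminus perp_lat_R_perp perp_measure_translate borel_measurable_perp_measure\<close>)
  then show ?thesis using k by simp
qed

context
  fixes b :: "'p R"
  assumes b: "b \<in> Z_lat" "fourier 1 b \<noteq> 0"
begin

text \<open>The quantizer returns the projection of \<open>l\<close>, and adding the mean of
  \<open>x\<close> gives \<open>l\<close> shifted by the constant \<tau> in every coordinate. As
  \<open>l\<close> is integral, rounding replaces \<tau> by \<open>round \<tau>\<close> everywhere,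
  so the rounding error is a multiple of \<open>Phi\<close>, orthogonal to the rest.\<close>

lemma signing_error:
  assumes l: "l \<in> Z_lat" "perp l = mult_perp b p" and p: "p \<in> perp_lat" "perp v - p \<in> voronoi"
    and x: "x = mult_perp b v"
  shows "sq_len (signing Q (fourier 1 b) x - x)
    = sq_len (perp (x - l)) + real CARD('p) * (of_int (round (mean (x - l))) - mean (x - l))\<^sup>2"
proof -
  define \<tau> where "\<tau> = mean (x - l)"
  have Qv: "iota (Q (perp v)) = p"
    using p by (intro nearest_quantizer_eq[OF prime_card odd_card Q]) auto
  have "Q (perp v) \<in> cyc_int CARD('p)" using Q by (simp add: nearest_quantizer_def)
  then obtain g :: "'p R" where g: "g \<in> Z_lat" "Q (perp v) = fourier 1 g" unfolding cyc_int_eq[where 'p = 'p] by blast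
  then have pg: "p = perp g" using Qv iota_fourier[OF prime_card odd_card g(1)] by simp
  have "Q_scaled Q (fourier 1 b) x = fourier 1 (conv b g)"
    unfolding Q_scaled_def x u_div_eq[OF prime_card odd_card b] g(2) fourier_conv ..
  then have "iota (Q_scaled Q (fourier 1 b) x) = perp (conv b g)"
    using iota_fourier[OF prime_card odd_card Z_lat_conv[OF b(1) g(1)]] by simp
  also have "\<dots> = perp l" by (simp add: perp_conv l(2) pg)
  finally have i: "iota (Q_scaled Q (fourier 1 b) x) = perp l" .
  have "signing Q (fourier 1 b) x $ i = l $ i + of_int (round \<tau>)" for i
  proof -
    obtain k :: int where k: "l $ i = of_int k" using l(1) by (auto simp: Z_lat_def elim: Ints_cases)
    have "(perp l + pi0 x) $ i = of_int k + \<tau>"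
      by (simp add: pi0_eq Phi_def \<tau>_def linear_diff[OF linear_mean] k)
    \<comment> \<open>Ties in \<open>round\<close> always go up, so it commutes with integer shifts
      without exception.\<close>
    moreover have "round (of_int k + \<tau>) = k + round \<tau>"
      by (simp add: round_def add.assoc)
    ultimately show ?thesis by (simp only: signing_def i k vec_lambda_beta of_int_add)
  qed
  then have "signing Q (fourier 1 b) x - x = perp (l - x) + (of_int (round \<tau>) - \<tau>) *\<^sub>R Phi"
    by (simp add: vec_eq_iff Phi_def \<tau>_def linear_diff[OF linear_mean])
  then have "sq_len (signing Q (fourier 1 b) x - x)
      = sq_len (perp (l - x)) + real CARD('p) * (of_int (round \<tau>) - \<tau>)\<^sup>2"
    by (simp add: sq_len_add_Phi)
  also have "sq_len (perp (l - x)) = sq_len (perp (x - l))"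
    by (simp add: linear_diff[OF linear_perp] sq_len_eq_norm norm_minus_commute)
  finally show ?thesis by (simp add: \<tau>_def)
qed

text \<open>On the cylinder \<open>W\<close> the two orthogonal errors separate: the part in
  \<open>R_perp\<close> is pulled back to the Voronoi cell by \<open>mult_perp b\<close>, and the
  mean runs through an interval of length 1.\<close>

lemma Delta_signing_eq:
  assumes D: "fundamental_domain lebesgue (L_lat (fourier 1 b)) D"
    and w: "slab_integral (indicator (voronoi :: 'p R set)) = ennreal w" "0 < w"
    and r: "slab_integral (\<lambda>u :: 'p R. indicator voronoi u * ennreal (sq_len (mult_perp b u))) = ennreal r" "0 \<le> r"
  shows "Delta_signing Q (fourier 1 b) D = r / w + real CARD('p) / 12"
proof -
  let ?N = "real CARD('p)" and ?T = "mult_perp b" and ?L = "L_lat (fourier 1 b) :: 'p R set"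
  note bijT = bij_mult_perp[OF prime_card odd_card b]
  note L_iff = L_lat_iff[OF prime_card odd_card b]
  obtain S where S: "linear S" "\<And>x. S (?T x) = x" "\<And>x. ?T (S x) = x"
    using linear_injective_isomorphism[OF linear_mult_perp bij_is_inj[OF bijT]] by blast
  have bijS: "bij S" using S(2,3) by (intro bij_betw_byWitness[of _ ?T]) auto
  have meanS: "mean (S x) = mean x" for x by (metis S(3) mean_mult_perp)
  have perpS: "perp (S x) = S (perp x)" for x by (metis S(2,3) perp_mult_perp)
  have [measurable]: "S \<in> borel_measurable borel" using S(1) by (rule linear_borel_measurable)
  have [measurable]: "?T \<in> borel_measurable borel" using linear_mult_perp by (rule linear_borel_measurable)
  \<comment> \<open>The image of the Voronoi cell under \<open>?T\<close>, thickened by means in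
    \<open>{0..<1}\<close>.\<close>
  define W where "W = {x. S (perp x) \<in> voronoi \<and> mean x \<in> {0..<1}}"
  have W_iff: "x \<in> W \<longleftrightarrow> perp (S x) \<in> voronoi \<and> mean x \<in> {0..<1}" for x by (simp add: W_def perpS)
  have [measurable]: "W \<in> sets borel" unfolding W_def by measurable
  define h where "h x = sq_len (perp x) + ?N * (of_int (round (mean x)) - mean x)\<^sup>2" for x :: "'p R"
  have h_nonneg: "0 \<le> h x" for x by (simp add: h_def)
  have h_meas [measurable]: "h \<in> borel_measurable borel" unfolding h_def[abs_def] round_def by measurable
  have AE_W: "AE x in lborel. \<exists>!l. l \<in> ?L \<and> x - l \<in> W"
  proof -
    have "AE x in lborel. S x \<notin> {v :: 'p R. perp v \<in> ties}"
      using AE_perp_notin_ties by (intro AE_lborel_linear_bij[OF S(1) bijS]) simp_all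
    then show ?thesis
    proof eventually_elim
      case (elim x)
      then obtain p where p: "p \<in> perp_lat" "perp (S x) - p \<in> voronoi"
        and p_unique: "\<And>q. q \<in> perp_lat \<Longrightarrow> perp (S x) - q \<in> voronoi \<Longrightarrow> q = p"
        using ex1_voronoi[OF prime_card odd_card Q, of "perp (S x)"] by auto
      obtain g where g: "g \<in> Z_lat" "p = perp g" using p(1) by (auto simp: perp_lat_def)
      \<comment> \<open>\<open>conv b g\<close> is an integer vector over the required point of the
        hyperplane; the floor selects the element of its fibre that puts the mean of
        \<open>x - l\<close> into \<open>{0..<1}\<close>.\<close>
      define l where "l = conv b g + of_int \<lfloor>mean x - mean (conv b g)\<rfloor> *\<^sub>R Phi"
      have lZ: "l \<in> Z_lat" unfolding l_def using b(1) g(1) by (intro Z_lat_add Z_lat_conv Z_lat_int_Phi) auto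
      have perp_l: "perp l = ?T p"
        by (simp add: l_def linear_add[OF linear_perp] linear_scale[OF linear_perp] perp_conv g(2))
      have W_shift: "x - m \<in> W \<longleftrightarrow> perp (S x) - q \<in> voronoi \<and> mean x - mean m \<in> {0..<1}"
        if "perp m = ?T q" for m q
        unfolding W_iff by (simp add: linear_diff[OF S(1)] linear_diff[OF linear_perp] linear_diff[OF linear_mean]
            perpS that S(2))
      show ?case
      proof (rule ex1I[of _ l])
        have "l \<in> ?L" unfolding L_iff using lZ perp_l g by auto
        moreover have "mean x - mean l \<in> {0..<1}"
          unfolding l_def linear_add[OF linear_mean] linear_scale[OF linear_mean]
          by simp linarith
        ultimately show "l \<in> ?L \<and> x - l \<in> W" using p(2) by (simp add: W_shift[OF perp_l])
        fix m assume m: "m \<in> ?L \<and> x - m \<in> W"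
        then obtain g' where g': "m \<in> Z_lat" "g' \<in> Z_lat" "perp m = ?T (perp g')" unfolding L_iff by blast
        then have v: "perp (S x) - perp g' \<in> voronoi" "mean x - mean m \<in> {0..<1}" using m W_shift by blast+
        have "perp g' = p" using p_unique[OF _ v(1)] g'(2) by (simp add: perp_lat_def)
        then have "perp m = perp l" using g'(3) perp_l by simp
        \<comment> \<open>Two candidates over the same point differ by a multiple of
          \<open>Phi\<close>. The factor is an integer of absolute value below 1, hence 0.\<close>
        then have "m $ 0 - l $ 0 = mean m - mean l" by (metis perp_nth diff_eq_eq add_diff_eq diff_add_eq diff_diff_eq2 add.commute)
        moreover have "m $ 0 - l $ 0 \<in> \<int>" using g'(1) lZ by (simp add: Z_lat_def)
        moreover have "\<bar>mean m - mean l\<bar> < 1" using v(2) \<open>mean x - mean l \<in> {0..<1}\<close> by auto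
        ultimately have "mean m = mean l" using Ints_nonzero_abs_less1[of "mean m - mean l"] by auto
        with \<open>perp m = perp l\<close> show "m = l" by (simp add: perp_def)
      qed
    qed
  qed
  \<comment> \<open>The Jacobian of multiplication by \<open>b\<close>; it multiplies both the error
    integral and the volume of \<open>W\<close>.\<close>
  obtain c where c: "0 < c" "\<And>G. G \<in> borel_measurable borel \<Longrightarrow> slab_integral G = ennreal c * slab_integral (\<lambda>u. G (?T u))"
    using slab_integral_linear[OF linear_mult_perp bijT] by (metis mean_mult_perp perp_mult_perp)
  have "Delta_signing Q (fourier 1 b) D = (c * (r + ?N / 12 * w)) / (c * w)"
    unfolding Delta_signing_def
  proof (rule integral_uniform_measure_fundamental_domain)
    show "fundamental_domain (completion lborel) ?L D" by (rule D)
    show "fundamental_domain lborel ?L W" unfolding fundamental_domain_def using AE_W by simp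
    show "countable ?L"
      by (rule countable_subset[OF _ countable_Z_lat]) (auto simp: L_lat_def)
    show "- l \<in> ?L" if "l \<in> ?L" for l
    proof -
      obtain g where "l \<in> Z_lat" "g \<in> Z_lat" "perp l = ?T (perp g)" using \<open>l \<in> ?L\<close> unfolding L_iff by blast
      then have "- l \<in> Z_lat" "- g \<in> Z_lat" "perp (- l) = ?T (perp (- g))"
        by (simp_all add: Z_lat_def linear_neg[OF linear_perp] linear_neg[OF linear_mult_perp])
      then show ?thesis unfolding L_iff by blast
    qed
    show "(\<lambda>x. x + l) \<in> measurable lborel lborel" for l :: "'p R" by simp
    show "distr lborel lborel (\<lambda>x. x + l) = lborel" for l :: "'p R"
      using lborel_distr_plus[of l] by (simp add: add.commute cong: distr_cong)
    have "emeasure lborel W = (\<integral>\<^sup>+x. indicator voronoi (S (perp x)) * indicator {0..<1} (mean x) \<partial>lborel)"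
    proof -
      have "emeasure lborel W = (\<integral>\<^sup>+x. indicator W x \<partial>lborel)" by simp
      also have "\<dots> = (\<integral>\<^sup>+x. indicator voronoi (S (perp x)) * indicator {0..<1} (mean x) \<partial>lborel)"
        by (intro nn_integral_cong) (auto simp: W_def split: split_indicator)
      finally show ?thesis .
    qed
    also have "\<dots> = slab_integral (\<lambda>u. indicator voronoi (S u))"
      unfolding slab_integral_def by (simp add: mult.commute)
    also have "\<dots> = ennreal (c * w)"
      using c(1) w by (subst c(2)) (simp_all add: S(2) ennreal_mult)
    finally show "emeasure lborel W = ennreal (c * w)" .
    have "(\<integral>\<^sup>+x\<in>W. ennreal (h x) \<partial>lborel) = (\<integral>\<^sup>+x. indicator voronoi (S (perp x)) *
        ((ennreal (sq_len (perp x)) + ennreal ?N * ennreal ((of_int (round (mean x)) - mean x)\<^sup>2)) * indicator {0..<1} (mean x)) \<partial>lborel)"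
      by (auto simp: W_def h_def ennreal_mult intro!: nn_integral_cong split: split_indicator)
    also have "\<dots> = slab_integral (\<lambda>u. \<integral>\<^sup>+a. indicator voronoi (S u) *
        ((ennreal (sq_len u) + ennreal ?N * ennreal ((of_int (round a) - a)\<^sup>2)) * indicator {0..<1} a) \<partial>lborel)"
      unfolding round_def by (rule nn_integral_perp_mean) measurable
    also have "\<dots> = slab_integral (\<lambda>u. indicator voronoi (S u) * (ennreal (sq_len u) + ennreal (?N / 12)))"
    proof (rule slab_integral_cong)
      fix u :: "'p R"
      have "(\<integral>\<^sup>+a. (ennreal (sq_len u) + ennreal ?N * ennreal ((of_int (round a) - a)\<^sup>2)) * indicator {0..<1} a \<partial>lborel)
          = (\<integral>\<^sup>+a. ennreal (sq_len u) * indicator {0..<1} a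
              + ennreal ?N * (ennreal ((of_int (round a) - a)\<^sup>2) * indicator {0..<1 :: real} a) \<partial>lborel)"
        by (simp add: distrib_right mult.assoc)
      also have "\<dots> = (\<integral>\<^sup>+a. ennreal (sq_len u) * indicator {0..<1 :: real} a \<partial>lborel)
          + (\<integral>\<^sup>+a. ennreal ?N * (ennreal ((of_int (round a) - a)\<^sup>2) * indicator {0..<1 :: real} a) \<partial>lborel)"
        unfolding round_def by (rule nn_integral_add) measurable
      also have "(\<integral>\<^sup>+a. ennreal ?N * (ennreal ((of_int (round a) - a)\<^sup>2) * indicator {0..<1 :: real} a) \<partial>lborel)
          = ennreal ?N * (\<integral>\<^sup>+a. ennreal ((of_int (round a) - a)\<^sup>2) * indicator {0..<1 :: real} a \<partial>lborel)"
        unfolding round_def by (rule nn_integral_cmult) measurable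
      also have "\<dots> = ennreal (?N / 12)"
        unfolding nn_integral_square_rounding_error by (simp flip: ennreal_mult)
      finally have inner: "(\<integral>\<^sup>+a. (ennreal (sq_len u) + ennreal ?N * ennreal ((of_int (round a) - a)\<^sup>2)) * indicator {0..<1} a \<partial>lborel)
          = ennreal (sq_len u) + ennreal (?N / 12)"
        by (simp add: nn_integral_cmult_indicator)
      show "(\<integral>\<^sup>+a. indicator voronoi (S u) *
        ((ennreal (sq_len u) + ennreal ?N * ennreal ((of_int (round a) - a)\<^sup>2)) * indicator {0..<1} a) \<partial>lborel)
        = indicator voronoi (S u) * (ennreal (sq_len u) + ennreal (?N / 12))"
        unfolding inner[symmetric] unfolding round_def by (rule nn_integral_cmult) measurable
    qed
    \<comment> \<open>The substitution \<open>?T\<close> returns to the Voronoi cell itself; the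
      rounding term does not depend on the point and is unaffected.\<close>
    also have "\<dots> = ennreal c * slab_integral (\<lambda>u. indicator voronoi u * (ennreal (sq_len (?T u)) + ennreal (?N / 12)))"
      by (subst c(2)) (simp_all add: S(2))
    also have "slab_integral (\<lambda>u. indicator voronoi u * (ennreal (sq_len (?T u)) + ennreal (?N / 12)))
        = slab_integral (\<lambda>u. indicator voronoi u * ennreal (sq_len (?T u)) + ennreal (?N / 12) * indicator voronoi u)"
      by (simp add: distrib_left mult.commute)
    also have "\<dots> = slab_integral (\<lambda>u. indicator voronoi u * ennreal (sq_len (?T u)))
        + slab_integral (\<lambda>u :: 'p R. ennreal (?N / 12) * indicator voronoi u)"
      by (rule slab_integral_add) measurable
    also have "\<dots> = ennreal (r + ?N / 12 * w)"
    proof -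
      have "slab_integral (\<lambda>u :: 'p R. ennreal (?N / 12) * indicator voronoi u) = ennreal (?N / 12) * ennreal w"
        unfolding w(1)[symmetric] by (rule slab_integral_cmult) measurable
      also have "\<dots> = ennreal (?N / 12 * w)" by (rule ennreal_mult'[symmetric]) simp
      finally have eq: "slab_integral (\<lambda>u :: 'p R. ennreal (?N / 12) * indicator voronoi u) = ennreal (?N / 12 * w)" .
      have "0 \<le> ?N / 12 * w" using w(2) by simp
      then show ?thesis unfolding r(1) eq by (rule ennreal_plus[OF r(2), symmetric])
    qed
    also have "ennreal c * \<dots> = ennreal (c * (r + ?N / 12 * w))"
      using c(1) w r by (simp add: ennreal_mult)
    finally show "(\<integral>\<^sup>+x\<in>W. ennreal (h x) \<partial>lborel) = ennreal (c * (r + ?N / 12 * w))" .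
    show "sq_len (signing Q (fourier 1 b) x - x) = h (x - l)"
      if "x \<in> space lborel" "l \<in> ?L" "x - l \<in> W" for x l
    proof -
      obtain g where g: "l \<in> Z_lat" "g \<in> Z_lat" "perp l = ?T (perp g)" using \<open>l \<in> ?L\<close> unfolding L_iff by blast
      have "perp (S x) - perp g \<in> voronoi"
        using that(3) by (simp add: W_iff linear_diff[OF S(1)] linear_diff[OF linear_perp] perpS g(3) S(2))
      then show ?thesis
        unfolding h_def using g S(3) by (intro signing_error) (auto simp: perp_lat_def)
    qed
  qed (use c(1) w(2) r(2) h_meas h_nonneg in simp_all)
  also have "\<dots> = (r + ?N / 12 * w) / w" using c(1) by simp
  finally show ?thesis using w(2) by (simp add: add_divide_distrib)
qed

end

end

theorem theorem5:
  fixes N :: nat and \<beta> :: complex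
    and Q :: "'p::nontriv R \<Rightarrow> complex" and F D :: "'p R set"
  assumes "N = CARD('p)" and "prime N" and "odd N"
    and "\<beta> \<in> cyc_int N" and "\<beta> \<noteq> 0"
    and "nearest_quantizer Q"
    and "fundamental_domain lebesgue_perp (iota ` cyc_int N) F"
    and "fundamental_domain lebesgue (L_lat \<beta>) D"
  shows "Delta_signing Q \<beta> D =
           real N * (Delta_O Q F / (real N - 1) * sq_len_perp TYPE('p) \<beta> + 1 / 12)"
proof -
  have prime: "prime CARD('p)" and odd: "odd CARD('p)" and Q: "nearest_quantizer Q"
    using assms by auto
  have N1: "1 < N" using assms(2) by (rule prime_gt_1_nat)
  obtain b :: "'p R" where b: "b \<in> Z_lat" "\<beta> = fourier 1 b"
    using assms(1,4) cyc_int_eq[where 'p = 'p] by auto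
  obtain w where w: "slab_integral (indicator (voronoi :: 'p R set)) = ennreal w" "0 < w"
    using slab_integral_voronoi_finite[where 'p = 'p] slab_integral_voronoi_pos[OF prime odd Q]
    by (cases "slab_integral (indicator (voronoi :: 'p R set))") auto
  \<comment> \<open>\<open>x\<close> is the second moment of one Fourier component over the cell,
    the same for every nonzero index.\<close>
  obtain x where x: "slab_integral (\<lambda>u :: 'p R. indicator voronoi u * ennreal ((norm (fourier 1 u))\<^sup>2)) = ennreal x" "0 \<le> x"
    using slab_integral_voronoi_fourier_finite[where 'p = 'p]
    by (cases "slab_integral (\<lambda>u :: 'p R. indicator voronoi u * ennreal ((norm (fourier 1 u))\<^sup>2))") auto
  note voronoi_sum = slab_integral_voronoi_fourier_sum[OF prime x]
  have sq_len_R_perp: "sq_len u = (\<Sum>j=1..<CARD('p). 1 / real N * (norm (fourier j u))\<^sup>2)" if "u \<in> R_perp" for u :: "'p R"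
    using parseval_perp[of u] N1 unfolding sum_distrib_left[symmetric] perp_ident[OF that] assms(1)[symmetric]
    by (simp add: field_simps)
  have "slab_integral (\<lambda>u :: 'p R. indicator voronoi u * ennreal (sq_len u))
      = ennreal ((\<Sum>j=1..<CARD('p). 1 / real N) * x)"
    by (intro voronoi_sum sq_len_R_perp) simp
  then have "Delta_O Q F = (\<Sum>j=1..<CARD('p). 1 / real N) * x / w"
    using assms(1,7) w x(2) by (intro Delta_O_eq[OF prime odd Q]) (auto intro!: mult_nonneg_nonneg)
  \<comment> \<open>The N - 1 equal components give \<open>x / w\<close> as N times
    \<open>Delta_O Q F\<close> divided by N - 1, which is then substituted into the signing
    error.\<close>
  then have \<Delta>_O: "Delta_O Q F = (real N - 1) / real N * x / w"
    using N1 by (simp add: assms(1)[symmetric] of_nat_diff)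
  define s where "s = (\<Sum>j=1..<CARD('p). 1 / real N * (norm (fourier j b))\<^sup>2)"
  have "sq_len_perp TYPE('p) \<beta> = sq_len (perp b)"
    unfolding sq_len_perp_def b(2) iota_fourier[OF prime odd b(1)] ..
  also have "\<dots> = s"
    using parseval_perp[of b] N1 unfolding s_def sum_distrib_left[symmetric] assms(1)[symmetric]
    by (simp add: field_simps)
  finally have s: "sq_len_perp TYPE('p) \<beta> = s" .
  have "slab_integral (\<lambda>u :: 'p R. indicator voronoi u * ennreal (sq_len (mult_perp b u))) = ennreal (s * x)"
    unfolding s_def
  proof (rule voronoi_sum)
    fix u :: "'p R" assume "u \<in> R_perp"
    then have "mult_perp b u \<in> R_perp" by (simp add: R_perp_iff)
    then show "sq_len (mult_perp b u)
        = (\<Sum>j=1..<CARD('p). 1 / real N * (norm (fourier j b))\<^sup>2 * (norm (fourier j u))\<^sup>2)"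
      unfolding sq_len_R_perp[OF \<open>mult_perp b u \<in> R_perp\<close>]
      by (intro sum.cong refl) (simp add: fourier_mult_perp norm_mult power_mult_distrib)
  qed simp
  moreover have "0 \<le> s * x" unfolding s_def using x(2) by (intro mult_nonneg_nonneg sum_nonneg) auto
  ultimately have "Delta_signing Q \<beta> D = s * x / w + real N / 12"
    using assms(1,5,8) b w Delta_signing_eq[OF prime odd Q, of b D w "s * x"] by simp
  moreover have n: "real N - 1 \<noteq> 0" "real N \<noteq> 0" using N1 by auto
  ultimately show ?thesis
    unfolding \<Delta>_O s using n by (simp add: distrib_left)
qed

end
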